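(* Let $\Omega$ be a verification operator for $|\Psi\rangle$ with spectral gap $\nu=\nu(\Omega)$ and smallest eigenvalue $\tau=\tau(\Omega)$, let $0<\epsilon,\delta<1$, $F=1-\epsilon$, and for $0\le p<1$ let $\Omega_p=(1-p)\Omega+p\,1$. If $p=\nu/\mathrm e$, then $$N(\epsilon,\delta,\Omega_p)<\frac{h(\mathrm e^{-1}\nu,\nu,\tau)\ln(F\delta)^{-1}}{\epsilon}\le\frac{h(\mathrm e^{-1}\nu,\nu)\ln(F\delta)^{-1}}{\epsilon}\le\frac{\ln(F\delta)^{-1}}{(1-\nu+\mathrm e^{-1}\nu^2)\nu\epsilon}\le\frac{(1+\mathrm e\nu-\nu)\ln(F\delta)^{-1}}{\nu\epsilon}.$$ If $p_*(\nu,\tau)\le p\le p_*(\nu)$, then $$N(\epsilon,\delta,\Omega_p)<\frac{h(p,\nu,\tau)\ln(F\delta)^{-1}}{\epsilon}\le\frac{h_*(\nu)\ln(F\delta)^{-1}}{\epsilon}\le\frac{h(\mathrm e^{-1}\nu,\nu)\ln(F\delta)^{-1}}{\epsilon}\le\frac{\ln(F\delta)^{-1}}{(1-\nu+\mathrm e^{-1}\nu^2)\nu\epsilon}.$$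
   Context: Let $\mathcal H$ be a Hilbert space of finite dimension $D\ge2$ and $|\Psi\rangle\in\mathcal H$ a unit vector. A verification operator for $|\Psi\rangle$ is a Hermitian operator $\Omega$ on $\mathcal H$ with $0\le\Omega\le1$, $\Omega|\Psi\rangle=|\Psi\rangle$, whose eigenvalue $1$ is nondegenerate; $\beta$ is its second largest eigenvalue, $\nu=1-\beta$ its spectral gap and $\tau$ its smallest eigenvalue. For an integer $N\ge1$ and a density operator $\rho$ on $\mathcal H^{\otimes(N+1)}$ put $p_\rho=\mathrm{tr}[(\Omega^{\otimes N}\otimes 1)\rho]$, $f_\rho=\mathrm{tr}[(\Omega^{\otimes N}\otimes|\Psi\rangle\langle\Psi|)\rho]$, $F(N,\delta,\Omega)=\min\{f_\rho/p_\rho:p_\rho\ge\delta\}$ (minimum over permutation-invariant density operators on $\mathcal H^{\otimes(N+1)}$), and $N(\epsilon,\delta,\Omega)=\min\{N\ge1:F(N,\delta,\Omega)\ge1-\epsilon\}$. For real $0<\nu\le1$, $0\le\tau<1$ with $\nu+\tau\le1$ and $0\le p<1$, set $\beta_p=1-\nu+p\nu$, $\tau_p=(1-p)\tau+p$, $h(p,\nu,\tau)=[\min\{\beta_p\ln\beta_p^{-1},\tau_p\ln\tau_p^{-1}\}]^{-1}$ (when $\tau_p>0$), and $h(p,\nu)=h(p,\nu,0)$. Let $p_*(\nu,\tau)=\min\{p\ge0:\beta_p\ge\mathrm e^{-1}\text{ and }\tau_p\ln\tau_p^{-1}\ge\beta_p\ln\beta_p^{-1}\}$ (the minimizer of $h(\cdot,\nu,\tau)$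 over $[0,1)$), $h_*(\nu,\tau)=h(p_*(\nu,\tau),\nu,\tau)=\min_{0\le p<1}h(p,\nu,\tau)$, $p_*(\nu)=p_*(\nu,0)$ and $h_*(\nu)=h_*(\nu,0)$. *)

theory Defs
  imports "Jordan_Normal_Form.Char_Poly" "Jordan_Normal_Form.Conjugate"
begin

definition hermitian_mat :: "nat \<Rightarrow> complex mat \<Rightarrow> bool" where
  "hermitian_mat n A \<longleftrightarrow> A \<in> carrier_mat n n \<and>
     (\<forall>i<n. \<forall>j<n. A $$ (i, j) = cnj (A $$ (j, i)))"

text \<open>Positive semidefinite: Hermitian with nonnegative quadratic form
  (the form is real for Hermitian matrices).\<close>
definition psd_mat :: "nat \<Rightarrow> complex mat \<Rightarrow> bool" where
  "psd_mat n A \<longleftrightarrow> hermitian_mat n A \<and>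
     (\<forall>v \<in> carrier_vec n. 0 \<le> Re (conjugate v \<bullet> (A *\<^sub>v v)))"

definition mtrace :: "complex mat \<Rightarrow> complex" where
  "mtrace A = (\<Sum>i<dim_row A. A $$ (i, i))"

definition density_op :: "nat \<Rightarrow> complex mat \<Rightarrow> bool" where
  "density_op n \<rho> \<longleftrightarrow> psd_mat n \<rho> \<and> mtrace \<rho> = 1"

definition unit_vec_c :: "nat \<Rightarrow> complex vec \<Rightarrow> bool" where
  "unit_vec_c D \<psi> \<longleftrightarrow> \<psi> \<in> carrier_vec D \<and> (\<Sum>i<D. (cmod (\<psi> $ i))\<^sup>2) = 1"

definition proj_mat :: "nat \<Rightarrow> complex vec \<Rightarrow> complex mat" where
  "proj_mat D \<psi> = mat D D (\<lambda>(i, j). \<psi> $ i * cnj (\<psi> $ j))"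

definition verif_op :: "nat \<Rightarrow> complex vec \<Rightarrow> complex mat \<Rightarrow> bool" where
  "verif_op D \<psi> \<Omega> \<longleftrightarrow> hermitian_mat D \<Omega> \<and> psd_mat D \<Omega> \<and> psd_mat D (1\<^sub>m D - \<Omega>) \<and>
     \<Omega> *\<^sub>v \<psi> = \<psi> \<and>
     (\<forall>v. eigenvector \<Omega> v 1 \<longrightarrow> (\<exists>c. v = c \<cdot>\<^sub>v \<psi>))"

text \<open>Second largest eigenvalue (eigenvalue 1 being simple and maximal, it is
  the largest eigenvalue different from 1), spectral gap, smallest eigenvalue.\<close>
definition beta_op :: "complex mat \<Rightarrow> real" where
  "beta_op \<Omega> = Max {Re k | k. eigenvalue \<Omega> k \<and> k \<noteq> 1}"

definition nu_op :: "complex mat \<Rightarrow> real" where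
  "nu_op \<Omega> = 1 - beta_op \<Omega>"

definition tau_op :: "complex mat \<Rightarrow> real" where
  "tau_op \<Omega> = Min {Re k | k. eigenvalue \<Omega> k}"

definition Omega_p :: "nat \<Rightarrow> real \<Rightarrow> complex mat \<Rightarrow> complex mat" where
  "Omega_p D p \<Omega> = complex_of_real (1 - p) \<cdot>\<^sub>m \<Omega> + complex_of_real p \<cdot>\<^sub>m 1\<^sub>m D"

text \<open>Basis vectors of (C^D)^{\<otimes>n} are indexed by x < D^n; the i-th tensor factor
  of basis index x is its i-th base-D digit.\<close>
definition digit :: "nat \<Rightarrow> nat \<Rightarrow> nat \<Rightarrow> nat" where
  "digit D i x = (x div D ^ i) mod D"

definition tensor_pow_ext :: "nat \<Rightarrow> nat \<Rightarrow> complex mat \<Rightarrow> complex mat \<Rightarrow> complex mat" where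
  "tensor_pow_ext D N A B = mat (D ^ (N + 1)) (D ^ (N + 1))
     (\<lambda>(r, c). (\<Prod>i<N. A $$ (digit D i r, digit D i c)) * B $$ (digit D N r, digit D N c))"

definition perm_idx :: "nat \<Rightarrow> nat \<Rightarrow> (nat \<Rightarrow> nat) \<Rightarrow> nat \<Rightarrow> nat" where
  "perm_idx D n \<pi> x = (\<Sum>i<n. digit D (\<pi> i) x * D ^ i)"

definition perm_op :: "nat \<Rightarrow> nat \<Rightarrow> (nat \<Rightarrow> nat) \<Rightarrow> complex mat" where
  "perm_op D n \<pi> = mat (D ^ n) (D ^ n) (\<lambda>(r, c). if r = perm_idx D n \<pi> c then 1 else 0)"

definition perm_invariant :: "nat \<Rightarrow> nat \<Rightarrow> complex mat \<Rightarrow> bool" where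
  "perm_invariant D n \<rho> \<longleftrightarrow>
     (\<forall>\<pi>. \<pi> permutes {..<n} \<longrightarrow> perm_op D n \<pi> * \<rho> = \<rho> * perm_op D n \<pi>)"

definition p_rho :: "nat \<Rightarrow> nat \<Rightarrow> complex mat \<Rightarrow> complex mat \<Rightarrow> real" where
  "p_rho D N \<Omega> \<rho> = Re (mtrace (tensor_pow_ext D N \<Omega> (1\<^sub>m D) * \<rho>))"

definition f_rho :: "nat \<Rightarrow> complex vec \<Rightarrow> nat \<Rightarrow> complex mat \<Rightarrow> complex mat \<Rightarrow> real" where
  "f_rho D \<psi> N \<Omega> \<rho> = Re (mtrace (tensor_pow_ext D N \<Omega> (proj_mat D \<psi>) * \<rho>))"

text \<open>F(N,\<delta>,\<Omega>): minimum (taken as infimum; it is attained) of f/p over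
  permutation-invariant density operators on (C^D)^{\<otimes>(N+1)} with p \<ge> \<delta>.\<close>
definition Fmin :: "nat \<Rightarrow> complex vec \<Rightarrow> nat \<Rightarrow> real \<Rightarrow> complex mat \<Rightarrow> real" where
  "Fmin D \<psi> N \<delta> \<Omega> = Inf {f_rho D \<psi> N \<Omega> \<rho> / p_rho D N \<Omega> \<rho> | \<rho>.
      density_op (D ^ (N + 1)) \<rho> \<and> perm_invariant D (N + 1) \<rho> \<and> p_rho D N \<Omega> \<rho> \<ge> \<delta>}"

definition Nmin :: "nat \<Rightarrow> complex vec \<Rightarrow> real \<Rightarrow> real \<Rightarrow> complex mat \<Rightarrow> nat" where
  "Nmin D \<psi> \<epsilon> \<delta> \<Omega> = (LEAST N. N \<ge> 1 \<and> Fmin D \<psi> N \<delta> \<Omega> \<ge> 1 - \<epsilon>)"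

definition beta_p :: "real \<Rightarrow> real \<Rightarrow> real" where
  "beta_p p \<nu> = 1 - \<nu> + p * \<nu>"

definition tau_p :: "real \<Rightarrow> real \<Rightarrow> real" where
  "tau_p p \<tau> = (1 - p) * \<tau> + p"

definition hfun :: "real \<Rightarrow> real \<Rightarrow> real \<Rightarrow> real" where
  "hfun p \<nu> \<tau> = 1 / min (beta_p p \<nu> * ln (1 / beta_p p \<nu>)) (tau_p p \<tau> * ln (1 / tau_p p \<tau>))"

definition hfun0 :: "real \<Rightarrow> real \<Rightarrow> real" where
  "hfun0 p \<nu> = hfun p \<nu> 0"

definition pstar :: "real \<Rightarrow> real \<Rightarrow> real" where
  "pstar \<nu> \<tau> = Inf {p. p \<ge> 0 \<and> beta_p p \<nu> \<ge> exp (-1) \<and>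
      tau_p p \<tau> * ln (1 / tau_p p \<tau>) \<ge> beta_p p \<nu> * ln (1 / beta_p p \<nu>)}"

definition hstar :: "real \<Rightarrow> real \<Rightarrow> real" where
  "hstar \<nu> \<tau> = hfun (pstar \<nu> \<tau>) \<nu> \<tau>"

definition pstar0 :: "real \<Rightarrow> real" where
  "pstar0 \<nu> = pstar \<nu> 0"

definition hstar0 :: "real \<Rightarrow> real" where
  "hstar0 \<nu> = hstar \<nu> 0"

end

theory Submission
  imports Defs "Jordan_Normal_Form.Spectral_Radius" "HOL-Analysis.Elementary_Metric_Spaces"
begin

text \<open>
  In an eigenbasis of the test operator, a permutation-invariant state becomes a symmetric
  probability distribution on words of length \<open>N + 1\<close> over the eigenvalues. Let \<open>Y\<close> be the
  probability that all \<open>N + 1\<close> systems pass, so that \<open>f \<le> Y \<le> p\<close>. For a word with product of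
  eigenvalues \<open>y\<close>, averaging over the position of the unmeasured system bounds its contribution to
  \<open>p - f\<close> by \<open>h y ln (1/y) / (N + 1)\<close>, because \<open>1 \<le> h \<lambda> ln (1/\<lambda>)\<close> for all eigenvalues \<open>\<lambda> \<noteq> 1\<close>.
  Replacing \<open>y ln (1/y)\<close> by its tangent at \<open>y = F\<delta>\<close> gives
  \<open>p - f \<le> h ((L - 1) Y + F\<delta>) / (N + 1)\<close> with \<open>L = ln (1/(F\<delta>))\<close>.
  When \<open>N + 1 \<ge> h L / \<epsilon>\<close> this yields \<open>p - f \<le> \<epsilon> p\<close> if \<open>Y \<ge> F\<delta>\<close>, and \<open>p < \<delta>\<close> otherwise.

  The comparisons between the bounds only use that \<open>y ln (1/y)\<close> increases up to \<open>1/e\<close> and decreases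
  afterwards.
\<close>

section \<open>The function \<open>y ln (1/y)\<close> and the constants \<open>h\<close>\<close>

text \<open>The estimate for a single word breaks down at a zero eigenvalue: a word with one such
  letter has y = 0, yet it contributes when that letter is the unmeasured one. Mixing in the
  identity makes all eigenvalues positive, and a lemma on \<open>pstar\<close> secures this even
  where p = 0. The tangent replaces the function because an affine bound can be averaged over words
  knowing only Y and the total weight 1. Its point of contact is forced by the goal: f \<le> Y, p
  \<ge> \<delta> and f \<ge> F p together give Y \<ge> F\<delta>, so F\<delta> is the smallest Y
  that has to be allowed. The strict inequality for the number of tests comes from the unmeasured
  system: the requirement has the form N + 1 \<ge> X, and the least such N lies strictly below X.
  Since \<open>Fmin\<close> is an infimum and \<open>Nmin\<close> a least number, their values mean
  something only once a feasible state and an admissible N are exhibited.\<close>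

definition entr :: "real \<Rightarrow> real" where
  "entr y = y * ln (1 / y)"

text \<open>Concavity, in the form \<open>ln u \<le> u - 1\<close> at \<open>u = y / x\<close>. The
  right side is affine in \<open>x\<close> with slope \<open>ln (1 / y) - 1\<close>.\<close>

lemma entr_le_tangent:
  assumes "0 < x" "0 < y"
  shows "entr x \<le> x * (ln (1 / y) - 1) + y"
proof -
  have "ln (y / x) \<le> y / x - 1"
    using assms ln_le_minus_one[of "y / x"] by simp
  hence "x * (ln y - ln x) \<le> x * (y / x - 1)"
    using assms by (intro mult_left_mono) (auto simp: ln_div)
  thus ?thesis
    using assms by (simp add: entr_def ln_div algebra_simps)
qed

lemma entr_le_tangent':
  assumes "0 < x" "0 < y"
  shows "entr x \<le> entr y + (x - y) * (ln (1 / y) - 1)"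
  using entr_le_tangent[OF assms] by (simp add: entr_def algebra_simps)

text \<open>The slope of the tangent at \<open>y\<close> is \<open>ln (1 / y) - 1\<close>, so this
  locates its change of sign.\<close>

lemma one_le_ln_inverse_iff:
  fixes y :: real assumes "0 < y"
  shows "1 \<le> ln (1 / y) \<longleftrightarrow> y \<le> exp (-1)"
proof -
  have "y \<le> exp (-1) \<longleftrightarrow> ln y \<le> ln (exp (-1))"
    using assms by (subst ln_le_cancel_iff) auto
  thus ?thesis using assms by (simp add: ln_div)
qed

text \<open>The graph lies below the tangent at the larger point, whose slope is nonnegative there.
  The value \<open>x = 0\<close> is treated apart because the tangent estimate needs
  \<open>0 < x\<close>.\<close>

lemma entr_mono:
  assumes "0 \<le> x" "x \<le> y" "y \<le> exp (-1)"
  shows "entr x \<le> entr y"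
proof (cases "x = 0")
  case True
  show ?thesis
  proof (cases "y = 0")
    case False
    hence "0 < y" using assms by simp
    hence "0 \<le> y * ln (1 / y)" using assms one_le_ln_inverse_iff[of y]
      by (intro mult_nonneg_nonneg) linarith+
    thus ?thesis using True by (simp add: entr_def)
  qed (use True in simp)
next
  case False
  hence pos: "0 < x" "0 < y" using assms by auto
  have "(x - y) * (ln (1 / y) - 1) \<le> 0"
    using assms one_le_ln_inverse_iff[OF pos(2)] by (intro mult_nonpos_nonneg) auto
  thus ?thesis using entr_le_tangent'[OF pos] by linarith
qed

lemma entr_antimono:
  assumes "exp (-1) \<le> x" "x \<le> y"
  shows "entr y \<le> entr x"
proof -
  have pos: "0 < x" "0 < y" using assms exp_gt_zero[of "-1::real"] by linarith+
  have "ln (1 / x) \<le> 1"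
    using one_le_ln_inverse_iff[OF pos(1)] assms
    by (cases "x = exp (-1)") (auto simp: ln_div)
  hence "(y - x) * (ln (1 / x) - 1) \<le> 0"
    using assms by (intro mult_nonneg_nonpos) auto
  thus ?thesis using entr_le_tangent'[OF pos(2,1)] by linarith
qed

lemma entr_le_exp_minus_one:
  assumes "0 \<le> x"
  shows "entr x \<le> exp (-1)"
proof -
  have "entr (exp (-1)) = exp (-1)" by (simp add: entr_def ln_div)
  thus ?thesis using entr_mono[of x "exp (-1)"] entr_antimono[of "exp (-1)" x] assms
    by (cases "x \<le> exp (-1)") auto
qed

text \<open>A function that rises and then falls attains its minimum over an interval at an end
  point. Two values thereby control all eigenvalues between \<open>tau_p\<close> and
  \<open>beta_p\<close>.\<close>

lemma min_entr_le:
  assumes "0 < t" "t \<le> x" "x \<le> b"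
  shows "min (entr b) (entr t) \<le> entr x"
  using assms entr_mono[of t x] entr_antimono[of x b]
  by (cases "x \<le> exp (-1)") auto

lemma entr_pos:
  assumes "0 < x" "x < 1"
  shows "0 < entr x"
  using assms by (simp add: entr_def)

text \<open>Only the point 0 is delicate; there \<open>ln s \<le> s\<close> at
  \<open>s = 1 / sqrt y\<close> gives the bound \<open>2 * sqrt y\<close>. The point is needed
  because \<open>tau_p\<close> can vanish.\<close>

lemma continuous_on_entr: "continuous_on {0..} entr"
proof -
  have "continuous (at x within {0..}) entr" if "x \<ge> 0" for x
  proof (cases "x = 0")
    case True
    have bound: "norm (entr y) \<le> 2 * sqrt y" if "y \<in> {0..1}" for y
    proof (cases "y = 0")
      case False
      hence y: "0 < y" "y \<le> 1" using that by auto
      have "ln (1 / sqrt y) \<le> 1 / sqrt y"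
        using y ln_bound[of "1 / sqrt y"] by simp
      moreover have "ln (1 / y) = 2 * ln (1 / sqrt y)"
        using y by (simp add: ln_div ln_sqrt)
      ultimately have "entr y \<le> y * (2 * (1 / sqrt y))"
        unfolding entr_def using y by (intro mult_left_mono) auto
      also have "\<dots> = 2 * sqrt y"
        using real_div_sqrt[of y] y by (simp add: field_simps)
      finally show ?thesis
        using y by (simp add: entr_def)
    qed (simp add: entr_def)
    have ev: "eventually (\<lambda>y. norm (entr y) \<le> norm (2 * sqrt y) * 1) (at 0 within {0..})"
      unfolding eventually_at
      using bound by (intro exI[of _ 1]) (auto simp: dist_real_def)
    have "((\<lambda>y. 2 * sqrt y) \<longlongrightarrow> 2 * sqrt 0) (at 0 within {0..})"
      by (intro tendsto_intros)
    hence "(entr \<longlongrightarrow> 0) (at 0 within {0..})"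
      by (intro tendsto_0_le[OF _ ev]) simp
    thus ?thesis by (simp add: True continuous_within entr_def)
  next
    case False
    hence "isCont (\<lambda>y. y * ln (1 / y)) x"
      using that by (intro continuous_intros) auto
    thus ?thesis
      unfolding entr_def[abs_def] by (rule continuous_at_imp_continuous_at_within)
  qed
  thus ?thesis by (simp add: continuous_on_eq_continuous_within)
qed

section \<open>Bounds on exp 1 and elementary inequalities in the spectral gap\<close>

text \<open>The constant has to exceed 2.618..., the larger root of
  \<open>e\<^sup>2 - 3 * e + 1\<close>, whose sign decides \<open>1 - 1 / e \<le> e - 2\<close> in
  the last comparison of the bounds.\<close>

lemma exp_one_lower: "(263 / 100 :: real) \<le> exp 1"
proof -
  have "1 + 1/2 + (1/2)\<^sup>2 / 2 \<le> exp (1/2 :: real)"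
    by (rule exp_lower_Taylor_quadratic) simp
  hence "(13 / 8 :: real)\<^sup>2 \<le> (exp (1/2))\<^sup>2"
    by (intro power_mono) (auto simp: power2_eq_square)
  also have "\<dots> = exp 1" by (simp add: exp_double[symmetric])
  finally show ?thesis by (simp add: power2_eq_square)
qed

text \<open>The constant has to stay below \<open>2 * sqrt 2\<close>, so that
  \<open>2 * z\<^sup>2 - exp 1 * z + 1\<close> has negative discriminant.\<close>

lemma exp_one_upper: "exp 1 \<le> (282 / 100 :: real)"
proof -
  have "15 / 16 \<le> exp (-1/16 :: real)"
    using exp_ge_add_one_self[of "-1/16 :: real"] by simp
  hence "(15 / 16) ^ 16 \<le> exp (-1/16 :: real) ^ 16"
    by (intro power_mono) auto
  also have "\<dots> = exp (-1)" by (simp add: exp_of_nat_mult[symmetric])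
  also have "\<dots> = 1 / exp 1" by (simp add: exp_minus field_simps)
  finally have "exp 1 \<le> 1 / (15 / 16 :: real) ^ 16" by (simp add: field_simps)
  also have "\<dots> \<le> 282 / 100" by (simp add: field_simps)
  finally show ?thesis .
qed

lemma quadratic_le_exp_minus:
  fixes x :: real
  assumes "0 < x" "x \<le> 1"
  shows "1 - x + x\<^sup>2 / exp 1 \<le> exp (- x)"
proof -
  \<comment> \<open>\<open>(exp (-x) - 1 + x) / x\<^sup>2\<close> is decreasing and equals \<open>1 / exp 1\<close> at \<open>x = 1\<close>.\<close>
  define k where "k y = 2 - y - (y + 2) * exp (- y)" for y :: real
  \<comment> \<open>The derivative of the quotient \<open>r\<close> below is
    \<open>k z / z ^ 3\<close>. Here \<open>k 0 = 0\<close>, and \<open>1 + z \<le> exp z\<close>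
    makes \<open>k\<close> nonincreasing.\<close>
  have k: "k y \<le> 0" if "0 \<le> y" for y
  proof -
    have "k y \<le> k 0"
    proof (rule DERIV_nonpos_imp_nonincreasing[OF that])
      fix z :: real assume z: "0 \<le> z" "z \<le> y"
      have "(k has_real_derivative (- 1 + (1 + z) * exp (- z))) (at z)"
        unfolding k_def by (auto intro!: derivative_eq_intros simp: algebra_simps)
      moreover have "(1 + z) * exp (- z) \<le> exp z * exp (- z)"
        by (intro mult_right_mono exp_ge_add_one_self) auto
      hence "- 1 + (1 + z) * exp (- z) \<le> 0" by (simp add: exp_minus)
      ultimately show "\<exists>d. (k has_real_derivative d) (at z) \<and> d \<le> 0" by blast
    qed
    thus ?thesis by (simp add: k_def)
  qed
  define r where "r y = (exp (- y) - 1 + y) / y\<^sup>2" for y :: real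
  have "r 1 \<le> r x"
  proof (rule DERIV_nonpos_imp_nonincreasing[OF assms(2)])
    fix z :: real assume z: "x \<le> z" "z \<le> 1"
    hence z0: "0 < z" using assms by simp
    have "(r has_real_derivative (k z / z ^ 3)) (at z)"
      unfolding r_def k_def using z0
      by (auto intro!: derivative_eq_intros simp: field_simps power2_eq_square power3_eq_cube)
    moreover have "k z / z ^ 3 \<le> 0"
      using k[of z] z0 by (simp add: divide_nonpos_pos)
    ultimately show "\<exists>d. (r has_real_derivative d) (at z) \<and> d \<le> 0" by blast
  qed
  moreover have "r 1 = 1 / exp 1" by (simp add: r_def exp_minus field_simps)
  ultimately have "1 / exp 1 * x\<^sup>2 \<le> r x * x\<^sup>2"
    by (intro mult_right_mono) auto
  thus ?thesis using assms by (simp add: r_def)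
qed

text \<open>The difference \<open>g\<close> of the two sides vanishes at 1, and \<open>z\<close>
  times its derivative is \<open>- (2 * z\<^sup>2 - exp 1 * z + 1)\<close>, which is never
  positive.\<close>

lemma quadratic_le_one_minus_ln:
  fixes x :: real
  assumes "0 < x" "x \<le> 1"
  shows "exp 1 - exp 1 * x + x\<^sup>2 \<le> 1 - ln x"
proof -
  define g where "g y = 1 - ln y - exp 1 + exp 1 * y - y\<^sup>2" for y :: real
  have "g 1 \<le> g x"
  proof (rule DERIV_nonpos_imp_nonincreasing[OF assms(2)])
    fix z :: real assume z: "x \<le> z" "z \<le> 1"
    hence z0: "0 < z" using assms by simp
    have "(g has_real_derivative (- (1 / z) + exp 1 - 2 * z)) (at z)"
      unfolding g_def using z0
      by (auto intro!: derivative_eq_intros simp: field_simps power2_eq_square)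
    moreover have "- (1 / z) + exp 1 - 2 * z \<le> 0"
    proof -
      have "exp 1 * z \<le> 282 / 100 * z" using exp_one_upper z0 by (intro mult_right_mono) auto
      \<comment> \<open>The value 705/1000 is 2.82 / 4, the vertex of
        \<open>2 * z\<^sup>2 - 2.82 * z + 1\<close>.\<close>
      also have "\<dots> \<le> 1 + 2 * z\<^sup>2"
        using zero_le_power2[of "z - 705/1000"] by (simp add: power2_eq_square algebra_simps)
      finally show ?thesis using z0 by (simp add: field_simps power2_eq_square)
    qed
    ultimately show "\<exists>d. (g has_real_derivative d) (at z) \<and> d \<le> 0" by blast
  qed
  thus ?thesis by (simp add: g_def)
qed

section \<open>Comparison of the constants h\<close>

lemma hfun_entr: "hfun p \<nu> \<tau> = 1 / min (entr (beta_p p \<nu>)) (entr (tau_p p \<tau>))"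
  by (simp add: hfun_def entr_def)

lemma beta_p_mono: "0 \<le> \<nu> \<Longrightarrow> p \<le> q \<Longrightarrow> beta_p p \<nu> \<le> beta_p q \<nu>"
  by (simp add: beta_p_def mult_right_mono)

lemma tau_p_mono: "\<tau> \<le> 1 \<Longrightarrow> p \<le> q \<Longrightarrow> tau_p p \<tau> \<le> tau_p q \<tau>"
  using mult_right_mono[of p q "1 - \<tau>"] by (simp add: tau_p_def algebra_simps)

lemma beta_p_less_one: "0 < \<nu> \<Longrightarrow> p < 1 \<Longrightarrow> beta_p p \<nu> < 1"
  by (simp add: beta_p_def)

lemma tau_p_le_beta_p:
  assumes "\<nu> + \<tau> \<le> 1" "p \<le> 1"
  shows "tau_p p \<tau> \<le> beta_p p \<nu>"
  using mult_left_mono[of \<tau> "1 - \<nu>" "1 - p"] assms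
  by (simp add: tau_p_def beta_p_def algebra_simps)

lemma tau_p_ge:
  assumes "0 \<le> \<tau>" "p \<le> 1"
  shows "p \<le> tau_p p \<tau>"
  using assms by (simp add: tau_p_def)

text \<open>A positive \<tau> only moves \<open>tau_p\<close> from \<open>p\<close> into the
  interval between \<open>p\<close> and \<open>beta_p\<close>, where \<open>entr\<close> cannot drop
  below the smaller of its end values.\<close>

lemma hfun_le_hfun0:
  assumes "0 < \<nu>" "0 \<le> \<tau>" "\<nu> + \<tau> \<le> 1" "0 < p" "p < 1"
  shows "hfun p \<nu> \<tau> \<le> hfun0 p \<nu>"
proof -
  note le = tau_p_ge[of \<tau> p] tau_p_le_beta_p[of \<nu> \<tau> p] beta_p_less_one[of \<nu> p]
  have "0 < min (entr (beta_p p \<nu>)) (entr p)"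
    using assms le by (auto intro!: entr_pos)
  moreover have "min (entr (beta_p p \<nu>)) (entr p) \<le> entr (tau_p p \<tau>)"
    using assms le by (intro min_entr_le) auto
  ultimately show ?thesis
    unfolding hfun0_def hfun_entr by (intro divide_left_mono) (auto simp: tau_p_def)
qed

text \<open>Both terms of the minimum are at least \<open>?b * \<nu>\<close>, where
  \<open>?b\<close> is \<open>beta_p\<close> at this \<open>p\<close>: the first because
  \<open>?b \<le> exp (- \<nu>)\<close>, the second because \<open>ln (1 / p) = 1 - ln \<nu>\<close>
  for \<open>p = \<nu> / exp 1\<close>.\<close>

lemma hfun0_nu_exp_le:
  assumes "0 < \<nu>" "\<nu> \<le> 1"
  shows "hfun0 (\<nu> / exp 1) \<nu> \<le> 1 / ((1 - \<nu> + \<nu>\<^sup>2 / exp 1) * \<nu>)"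
proof -
  let ?b = "1 - \<nu> + \<nu>\<^sup>2 / exp 1"
  have b0: "0 < ?b" using assms by (intro add_nonneg_pos) auto
  have "ln ?b \<le> ln (exp (- \<nu>))"
    using quadratic_le_exp_minus[OF assms] b0 by (subst ln_le_cancel_iff) auto
  hence "?b * \<nu> \<le> entr ?b"
    unfolding entr_def using b0 by (intro mult_left_mono) (auto simp: ln_div)
  moreover have "?b * \<nu> \<le> entr (\<nu> / exp 1)"
  proof -
    have "entr (\<nu> / exp 1) = \<nu> / exp 1 * (1 - ln \<nu>)"
      using assms by (simp add: entr_def ln_div)
    also have "\<dots> \<ge> \<nu> / exp 1 * (exp 1 - exp 1 * \<nu> + \<nu>\<^sup>2)"
      using quadratic_le_one_minus_ln[OF assms] assms by (intro mult_left_mono) auto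
    also have "\<nu> / exp 1 * (exp 1 - exp 1 * \<nu> + \<nu>\<^sup>2) = ?b * \<nu>"
      by (simp add: field_simps)
    finally show ?thesis .
  qed
  moreover have "beta_p (\<nu> / exp 1) \<nu> = ?b" by (simp add: beta_p_def power2_eq_square)
  moreover have "0 < ?b * \<nu>" using b0 assms by simp
  ultimately show ?thesis
    unfolding hfun0_def hfun_entr by (intro divide_left_mono) (auto simp: tau_p_def)
qed

text \<open>The product of the denominator with the right side equals 1 at both \<nu> = 0 and \<nu>
  = 1, so its excess over 1 contains the factor \<open>\<nu> * (1 - \<nu>)\<close>; the remaining
  factor is affine and is checked at \<nu> = 1.\<close>

lemma inverse_quadratic_le:
  fixes \<nu> :: real
  assumes "0 < \<nu>" "\<nu> \<le> 1"
  shows "1 / (1 - \<nu> + \<nu>\<^sup>2 / exp 1) \<le> 1 + exp 1 * \<nu> - \<nu>"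
proof -
  define e :: real where "e = exp 1"
  have e: "263 / 100 \<le> e" using exp_one_lower by (simp add: e_def)
  have b0: "0 < 1 - \<nu> + \<nu>\<^sup>2 / e" using assms e by (intro add_nonneg_pos) auto
  have "0 \<le> e - 2 - (1 - 1 / e) * \<nu>"
  proof -
    have "(1 - 1 / e) * \<nu> \<le> (1 - 1 / e) * 1"
      using assms e by (intro mult_left_mono) auto
    moreover have "0 \<le> (e - 263 / 100) * (e - 37 / 100)" using e by simp
    hence "1 - 1 / e \<le> e - 2" using e by (simp add: field_simps)
    ultimately show ?thesis by simp
  qed
  hence "0 \<le> \<nu> * ((1 - \<nu>) * (e - 2 - (1 - 1 / e) * \<nu>))"
    using assms by (intro mult_nonneg_nonneg) auto
  also have "\<dots> = (1 - \<nu> + \<nu>\<^sup>2 / e) * (1 + e * \<nu> - \<nu>) - 1"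
    using e by (simp add: field_simps power2_eq_square)
  finally show ?thesis
    using b0 unfolding e_def[symmetric] by (simp add: divide_le_eq mult.commute)
qed

section \<open>The minimizer of h\<close>

text \<open>The infimum defining \<open>pstar\<close> is attained, since the set is closed, nonempty
  and bounded below. Hence the defining inequalities hold at \<open>pstar\<close> itself.\<close>

lemma pstar_props:
  assumes "0 < \<nu>" "\<nu> \<le> 1" "0 \<le> \<tau>" "\<nu> + \<tau> \<le> 1"
  shows "0 \<le> pstar \<nu> \<tau>" "exp (-1) \<le> beta_p (pstar \<nu> \<tau>) \<nu>"
    "entr (beta_p (pstar \<nu> \<tau>) \<nu>) \<le> entr (tau_p (pstar \<nu> \<tau>) \<tau>)"
    "pstar \<nu> \<tau> \<le> exp (-1)"
    "\<And>p. 0 \<le> p \<Longrightarrow> exp (-1) \<le> beta_p p \<nu> \<Longrightarrow>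
        entr (beta_p p \<nu>) \<le> entr (tau_p p \<tau>) \<Longrightarrow> pstar \<nu> \<tau> \<le> p"
proof -
  define S where "S = {p. 0 \<le> p \<and> exp (-1) \<le> beta_p p \<nu> \<and>
      entr (beta_p p \<nu>) \<le> entr (tau_p p \<tau>)}"
  have pS: "pstar \<nu> \<tau> = Inf S" by (simp add: pstar_def S_def entr_def)
  have bdd: "bdd_below S" by (rule bdd_belowI[of _ 0]) (auto simp: S_def)
  show least: "\<And>p. 0 \<le> p \<Longrightarrow> exp (-1) \<le> beta_p p \<nu> \<Longrightarrow>
      entr (beta_p p \<nu>) \<le> entr (tau_p p \<tau>) \<Longrightarrow> pstar \<nu> \<tau> \<le> p"
    unfolding pS by (rule cInf_lower[OF _ bdd]) (auto simp: S_def)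
  have e1: "exp (-1) < (1::real)" by simp
  have le: "exp (-1) \<le> tau_p (exp (-1)) \<tau>" "tau_p (exp (-1)) \<tau> \<le> beta_p (exp (-1)) \<nu>"
    using tau_p_ge[of \<tau> "exp (-1)"] tau_p_le_beta_p[of \<nu> \<tau> "exp (-1)"] assms e1 by auto
  \<comment> \<open>At this witness both \<open>tau_p\<close> and \<open>beta_p\<close> lie on the
    decreasing branch of \<open>entr\<close>, where \<open>tau_p \<le> beta_p\<close> gives the
    required comparison.\<close>
  have mem: "exp (-1) \<in> S" unfolding S_def using le entr_antimono[OF le] by auto
  thus "pstar \<nu> \<tau> \<le> exp (-1)" unfolding pS by (rule cInf_lower[OF _ bdd])
  have tau0: "0 \<le> tau_p p \<tau>" if "0 \<le> p" for p
    using that assms tau_p_mono[of \<tau> 0 p] by (simp add: tau_p_def)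
  have beta0: "0 \<le> beta_p p \<nu>" if "0 \<le> p" for p
    using that assms by (simp add: beta_p_def)
  \<comment> \<open>Replacing \<open>p\<close> by \<open>max 0 p\<close> keeps the arguments of
    \<open>entr\<close> nonnegative on the whole line; on \<open>S\<close> nothing changes.\<close>
  have "continuous_on UNIV (\<lambda>p. entr (beta_p (max 0 p) \<nu>))"
    by (rule continuous_on_compose2[OF continuous_on_entr])
       (auto simp: beta_p_def[abs_def] intro!: continuous_intros beta0[unfolded beta_p_def])
  moreover have "continuous_on UNIV (\<lambda>p. entr (tau_p (max 0 p) \<tau>))"
    by (rule continuous_on_compose2[OF continuous_on_entr])
       (auto simp: tau_p_def[abs_def] intro!: continuous_intros tau0[unfolded tau_p_def])
  ultimately have "closed {p. entr (beta_p (max 0 p) \<nu>) \<le> entr (tau_p (max 0 p) \<tau>)}"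
    by (rule closed_Collect_le)
  moreover have "closed {p. exp (-1) \<le> beta_p p \<nu>}"
    unfolding beta_p_def by (intro closed_Collect_le continuous_intros)
  ultimately have "closed ({0..} \<inter> ({p. entr (beta_p (max 0 p) \<nu>) \<le> entr (tau_p (max 0 p) \<tau>)}
      \<inter> {p. exp (-1) \<le> beta_p p \<nu>}))" by (intro closed_Int closed_atLeast)
  also have "\<dots> = S" by (auto simp: S_def)
  finally have "closed S" .
  hence "pstar \<nu> \<tau> \<in> S" unfolding pS
    using mem bdd by (intro closed_contains_Inf) auto
  thus "0 \<le> pstar \<nu> \<tau>" "exp (-1) \<le> beta_p (pstar \<nu> \<tau>) \<nu>"
    "entr (beta_p (pstar \<nu> \<tau>) \<nu>) \<le> entr (tau_p (pstar \<nu> \<tau>) \<tau>)"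
    by (auto simp: S_def)
qed

text \<open>Here \<open>p\<close> may be 0. If \<open>tau_p\<close> vanished, then \<open>p\<close>
  would be \<open>pstar\<close>, and the defining inequality would give
  \<open>entr (beta_p p \<nu>) \<le> 0\<close>, although \<open>beta_p\<close> lies strictly between
  0 and 1.\<close>

lemma tau_p_pos_of_pstar_le:
  assumes "0 < \<nu>" "\<nu> \<le> 1" "0 \<le> \<tau>" "\<nu> + \<tau> \<le> 1" "pstar \<nu> \<tau> \<le> p" "p < 1"
  shows "0 < tau_p p \<tau>"
proof -
  note ps = pstar_props[OF assms(1-4)]
  have "tau_p p \<tau> \<noteq> 0"
  proof
    assume 0: "tau_p p \<tau> = 0"
    moreover have "p \<le> tau_p p \<tau>" using assms by (intro tau_p_ge) auto
    ultimately have "p = pstar \<nu> \<tau>" using ps(1) assms(5) by linarith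
    with 0 ps(3) have "entr (beta_p p \<nu>) \<le> 0" by (simp add: entr_def)
    moreover have "exp (-1) \<le> beta_p p \<nu>" using ps(2) \<open>p = pstar \<nu> \<tau>\<close> by simp
    hence "0 < entr (beta_p p \<nu>)"
      using assms beta_p_less_one[of \<nu> p] by (intro entr_pos less_le_trans[OF exp_gt_zero]) auto
    ultimately show False by simp
  qed
  moreover have "p \<le> tau_p p \<tau>" using assms by (intro tau_p_ge) auto
  ultimately show ?thesis using ps(1) assms(5) by linarith
qed

lemma hstar0_entr:
  assumes "0 < \<nu>" "\<nu> \<le> 1"
  shows "hstar0 \<nu> = 1 / entr (beta_p (pstar0 \<nu>) \<nu>)" "0 < entr (beta_p (pstar0 \<nu>) \<nu>)"
proof -
  note ps = pstar_props[of \<nu> 0, folded pstar0_def]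
  show "hstar0 \<nu> = 1 / entr (beta_p (pstar0 \<nu>) \<nu>)"
    using ps(3) assms by (simp add: hstar0_def hstar_def hfun_entr min_absorb1 flip: pstar0_def)
  have "pstar0 \<nu> < 1"
    using ps(4) assms le_less_trans[of "pstar0 \<nu>" "exp (-1)" 1] by simp
  thus "0 < entr (beta_p (pstar0 \<nu>) \<nu>)"
    using ps(2) assms beta_p_less_one[of \<nu> "pstar0 \<nu>"]
    by (intro entr_pos less_le_trans[OF exp_gt_zero]) auto
qed

text \<open>From \<open>pstar \<nu> \<tau>\<close> on, the minimum in h is its \<beta>-term, which
  decreases in \<open>p\<close>, so the worst case is the right end \<open>pstar0 \<nu>\<close>.
  While \<open>tau_p\<close> is below \<open>exp (-1)\<close>, the \<tau>-term still rises and the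
  comparison is inherited from \<open>pstar\<close>; afterwards both arguments are on the decreasing
  branch.\<close>

lemma hfun_le_hstar0:
  assumes "0 < \<nu>" "\<nu> \<le> 1" "0 \<le> \<tau>" "\<nu> + \<tau> \<le> 1" "pstar \<nu> \<tau> \<le> p" "p \<le> pstar0 \<nu>" "p < 1"
  shows "hfun p \<nu> \<tau> \<le> hstar0 \<nu>"
proof -
  note ps = pstar_props[OF assms(1-4)]
  let ?q = "pstar \<nu> \<tau>"
  have bq: "beta_p ?q \<nu> \<le> beta_p p \<nu>" using assms by (intro beta_p_mono) auto
  have be: "exp (-1) \<le> beta_p p \<nu>" using bq ps(2) by linarith
  have "entr (beta_p p \<nu>) \<le> entr (tau_p p \<tau>)"
  proof (cases "exp (-1) \<le> tau_p p \<tau>")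
    case True
    thus ?thesis using assms by (intro entr_antimono tau_p_le_beta_p) auto
  next
    case False
    have "entr (beta_p p \<nu>) \<le> entr (beta_p ?q \<nu>)"
      by (rule entr_antimono[OF ps(2) bq])
    also have "\<dots> \<le> entr (tau_p ?q \<tau>)" by (rule ps(3))
    also have "\<dots> \<le> entr (tau_p p \<tau>)"
    proof (rule entr_mono)
      show "0 \<le> tau_p ?q \<tau>" using tau_p_ge[of \<tau> ?q] ps(1) assms by linarith
    qed (use False assms in \<open>auto intro: tau_p_mono\<close>)
    finally show ?thesis .
  qed
  hence "hfun p \<nu> \<tau> = 1 / entr (beta_p p \<nu>)" by (simp add: hfun_entr min_absorb1)
  moreover have "entr (beta_p (pstar0 \<nu>) \<nu>) \<le> entr (beta_p p \<nu>)"
    using assms be by (intro entr_antimono beta_p_mono) auto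
  ultimately show ?thesis
    using hstar0_entr[OF assms(1,2)] by (simp add: frac_le)
qed

text \<open>Optimality of \<open>pstar0\<close> tested at the single competitor
  \<open>\<nu> / exp 1\<close>. A competitor satisfying the defining inequality lies to the right of
  \<open>pstar0\<close>, where the \<beta>-term is smaller; otherwise it lies to the left, where the
  \<tau>-term \<open>entr p\<close> has not yet reached the crossing value.\<close>

lemma hstar0_le_hfun0:
  assumes "0 < \<nu>" "\<nu> \<le> 1"
  shows "hstar0 \<nu> \<le> hfun0 (\<nu> / exp 1) \<nu>"
proof -
  note ps = pstar_props[of \<nu> 0, folded pstar0_def]
  let ?q = "\<nu> / exp 1" and ?p = "pstar0 \<nu>"
  have e: "2 \<le> exp (1::real)" using exp_ge_add_one_self[of 1] by simp
  have q: "0 < ?q" "?q < 1" using assms e by (auto simp: divide_less_eq)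
  have bq: "exp (-1) \<le> beta_p ?q \<nu>"
  proof -
    have "0 \<le> (1 - \<nu>) * (exp 1 - (1 + \<nu>)) / exp 1"
      using assms e by (intro divide_nonneg_nonneg mult_nonneg_nonneg) auto
    also have "\<dots> = beta_p ?q \<nu> - exp (-1)"
      by (simp add: beta_p_def exp_minus field_simps power2_eq_square)
    finally show ?thesis by simp
  qed
  have "min (entr (beta_p ?q \<nu>)) (entr ?q) \<le> entr (beta_p ?p \<nu>)"
  proof (cases "entr (beta_p ?q \<nu>) \<le> entr ?q")
    case True
    hence "?p \<le> ?q" using ps(5)[of ?q] q bq assms by (simp add: tau_p_def)
    hence "entr (beta_p ?q \<nu>) \<le> entr (beta_p ?p \<nu>)"
      using ps(2) assms by (intro entr_antimono beta_p_mono) auto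
    thus ?thesis by simp
  next
    case False
    have qp: "?q \<le> ?p"
    proof (rule ccontr)
      assume "\<not> ?q \<le> ?p"
      hence "?p \<le> ?q" by simp
      have "entr (beta_p ?q \<nu>) \<le> entr (beta_p ?p \<nu>)"
        using ps(2) assms \<open>?p \<le> ?q\<close> by (intro entr_antimono beta_p_mono) auto
      also have "\<dots> \<le> entr ?p" using ps(3) assms by (simp add: tau_p_def)
      also have "\<dots> \<le> entr ?q"
      proof (rule entr_mono)
        show "?q \<le> exp (-1)" using assms by (simp add: exp_minus field_simps)
      qed (use ps(1) assms \<open>?p \<le> ?q\<close> in auto)
      finally show False using False by simp
    qed
    have cont: "continuous_on {?q..?p} (\<lambda>p. entr p - entr (beta_p p \<nu>))"
    proof (intro continuous_on_diff)
      show "continuous_on {?q..?p} entr"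
        by (rule continuous_on_subset[OF continuous_on_entr]) (use q in auto)
      show "continuous_on {?q..?p} (\<lambda>p. entr (beta_p p \<nu>))"
        by (rule continuous_on_compose2[OF continuous_on_entr])
           (use q assms order.trans[of 0 ?q] in \<open>auto simp: beta_p_def[abs_def]
              intro!: continuous_intros add_nonneg_nonneg mult_nonneg_nonneg\<close>)
    qed
    have "entr ?p - entr (beta_p ?p \<nu>) \<ge> 0"
      using ps(3) assms by (simp add: tau_p_def)
    \<comment> \<open>The two curves cross at some \<open>r\<close> in between. Since
      \<open>r\<close> satisfies the defining inequalities, minimality of \<open>?p\<close> forces
      \<open>r = ?p\<close>, so the curves meet exactly there.\<close>
    with IVT'[of "\<lambda>p. entr p - entr (beta_p p \<nu>)" ?q 0 ?p, OF _ _ qp cont] False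
    obtain r where r: "?q \<le> r" "r \<le> ?p" "entr r = entr (beta_p r \<nu>)" by auto
    have "beta_p ?q \<nu> \<le> beta_p r \<nu>" using assms r by (intro beta_p_mono) auto
    hence "?p \<le> r" using ps(5)[of r] r q bq assms by (simp add: tau_p_def)
    hence "entr ?p = entr (beta_p ?p \<nu>)" using r by simp
    moreover have "entr ?q \<le> entr ?p"
      using qp q ps(4) assms by (intro entr_mono) auto
    ultimately show ?thesis by simp
  qed
  moreover have "0 < min (entr (beta_p ?q \<nu>)) (entr ?q)"
  proof -
    have "0 < beta_p ?q \<nu>" using bq exp_gt_zero[of "-1::real"] by linarith
    thus ?thesis using q assms beta_p_less_one[of \<nu> ?q] by (auto intro!: entr_pos)
  qed
  ultimately show ?thesis
    unfolding hstar0_entr(1)[OF assms] hfun0_def hfun_entr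
    by (auto simp: tau_p_def intro!: divide_left_mono mult_pos_pos hstar0_entr(2)[OF assms])
qed

section \<open>Spectral decomposition\<close>

definition dagger :: "complex mat \<Rightarrow> complex mat" where
  "dagger A = mat (dim_col A) (dim_row A) (\<lambda>(i, j). cnj (A $$ (j, i)))"

lemma dagger_carrier [simp]: "A \<in> carrier_mat n m \<Longrightarrow> dagger A \<in> carrier_mat m n"
  by (auto simp: dagger_def)

lemma dagger_index [simp]:
  "A \<in> carrier_mat n m \<Longrightarrow> i < m \<Longrightarrow> j < n \<Longrightarrow> dagger A $$ (i, j) = cnj (A $$ (j, i))"
  by (auto simp: dagger_def)

lemma mult_index:
  assumes "A \<in> carrier_mat n m" "B \<in> carrier_mat m k" "i < n" "j < k"
  shows "(A * B) $$ (i, j) = (\<Sum>l<m. A $$ (i, l) * B $$ (l, j))"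
  using assms by (auto simp: scalar_prod_def lessThan_atLeast0 intro!: sum.cong)

lemma mult_vec_index:
  assumes "A \<in> carrier_mat n m" "v \<in> carrier_vec m" "i < n"
  shows "(A *\<^sub>v v) $ i = (\<Sum>l<m. A $$ (i, l) * v $ l)"
  using assms by (auto simp: scalar_prod_def lessThan_atLeast0 intro!: sum.cong)

lemma dagger_mult:
  assumes "A \<in> carrier_mat n m" "B \<in> carrier_mat m k"
  shows "dagger (A * B) = dagger B * dagger A"
proof (rule eq_matI)
  fix i j assume "i < dim_row (dagger B * dagger A)" "j < dim_col (dagger B * dagger A)"
  hence ij: "i < k" "j < n" using assms by (auto simp: dagger_def)
  have "dagger (A * B) $$ (i, j) = cnj (\<Sum>l<m. A $$ (j, l) * B $$ (l, i))"
    using ij assms mult_index[OF assms, of j i]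
    by (subst dagger_index[of _ n k]) (auto simp del: index_mult_mat)
  also have "\<dots> = (dagger B * dagger A) $$ (i, j)"
    using ij assms
    by (subst mult_index[OF dagger_carrier[OF assms(2)] dagger_carrier[OF assms(1)]])
       (auto intro!: sum.cong)
  finally show "dagger (A * B) $$ (i, j) = (dagger B * dagger A) $$ (i, j)" .
qed (use assms in \<open>auto simp: dagger_def\<close>)

lemma dagger_dagger [simp]: "dagger (dagger A) = A"
  by (rule eq_matI) (auto simp: dagger_def)

lemma hermitian_mat_iff_dagger:
  "hermitian_mat n A \<longleftrightarrow> A \<in> carrier_mat n n \<and> dagger A = A"
proof
  assume h: "hermitian_mat n A"
  hence A: "A \<in> carrier_mat n n" by (simp add: hermitian_mat_def)
  have "dagger A $$ (i, j) = A $$ (i, j)" if "i < n" "j < n" for i j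
  proof -
    have "dagger A $$ (i, j) = cnj (A $$ (j, i))"
      using dagger_index[OF A] that by simp
    also have "\<dots> = A $$ (i, j)" using h that unfolding hermitian_mat_def by metis
    finally show ?thesis .
  qed
  thus "A \<in> carrier_mat n n \<and> dagger A = A"
    using A by (intro conjI eq_matI) (auto simp: dagger_def)
next
  assume A: "A \<in> carrier_mat n n \<and> dagger A = A"
  have "A $$ (i, j) = cnj (A $$ (j, i))" if "i < n" "j < n" for i j
    using dagger_index[of A n n i j] A that by simp
  thus "hermitian_mat n A" unfolding hermitian_mat_def using A by blast
qed

text \<open>Gram-Schmidt applied to a basis starting with \<open>v\<close> keeps \<open>v\<close>
  but gives vectors that are only orthogonal. The columns are therefore divided by their norms, and
  the first one is merely proportional to \<open>v\<close>.\<close>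

lemma exists_unitary_first_col:
  fixes v :: "complex vec"
  assumes v: "v \<in> carrier_vec n" "v \<noteq> 0\<^sub>v n"
  obtains W c where "W \<in> carrier_mat n n" "dagger W * W = 1\<^sub>m n" "W * dagger W = 1\<^sub>m n"
    "col W 0 = c \<cdot>\<^sub>v v"
proof -
  interpret cof_vec_space n "TYPE(complex)" .
  define b where "b = basis_completion v"
  define ws where "ws = gram_schmidt n b"
  note bc = basis_completion[OF v, folded b_def]
  have n: "n \<noteq> 0" using v by auto
  from bc(6,7) n obtain vs where bv: "b = v # vs" by (cases b) auto
  from gram_schmidt_result[OF bc(2) bc(4) bc(5) refl, folded ws_def]
  have ws: "set ws \<subseteq> carrier_vec n" "corthogonal ws" "length ws = n"
    by (auto simp: bc(6))
  have hd: "hd ws = v"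
    using gram_schmidt_hd[OF v(1), of vs, folded bv] unfolding ws_def .
  hence ws0: "ws ! 0 = v" using ws n by (cases ws) auto
  have wsc: "ws ! j \<in> carrier_vec n" if "j < n" for j using ws that by auto
  define r where "r j = (\<Sum>i<n. (cmod (ws ! j $ i))\<^sup>2)" for j
  have ip: "ws ! j \<bullet>c ws ! k = (\<Sum>i<n. ws ! j $ i * cnj (ws ! k $ i))" if "j < n" "k < n" for j k
    using wsc[OF that(1)] wsc[OF that(2)]
    by (auto simp: scalar_prod_def lessThan_atLeast0 intro!: sum.cong)
  have rip: "complex_of_real (r j) = ws ! j \<bullet>c ws ! j" if "j < n" for j
    unfolding ip[OF that that] r_def of_real_sum by (intro sum.cong refl complex_norm_square)
  have r0: "0 < r j" if "j < n" for j
  proof -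
    have "ws ! j \<bullet>c ws ! j \<noteq> 0" using corthogonalD[OF ws(2), of j j] ws(3) that by auto
    hence "r j \<noteq> 0" using rip[OF that] by auto
    moreover have "0 \<le> r j" unfolding r_def by (intro sum_nonneg) auto
    ultimately show ?thesis by simp
  qed
  define W where "W = mat n n (\<lambda>(i, j). ws ! j $ i / complex_of_real (sqrt (r j)))"
  have W: "W \<in> carrier_mat n n" by (simp add: W_def)
  have WW: "dagger W * W = 1\<^sub>m n"
  proof (rule eq_matI)
    fix j k assume "j < dim_row (1\<^sub>m n)" "k < dim_col (1\<^sub>m n)"
    hence jk: "j < n" "k < n" by auto
    have "(dagger W * W) $$ (j, k) = (\<Sum>i<n. cnj (W $$ (i, j)) * W $$ (i, k))"
      using W jk by (subst mult_index[OF dagger_carrier[OF W] W]) auto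
    also have "\<dots> = (\<Sum>i<n. ws ! k $ i * cnj (ws ! j $ i)) /
        (complex_of_real (sqrt (r j)) * complex_of_real (sqrt (r k)))"
      unfolding sum_divide_distrib using jk by (intro sum.cong) (auto simp: W_def)
    also have "\<dots> = (ws ! k \<bullet>c ws ! j) / (complex_of_real (sqrt (r j)) * complex_of_real (sqrt (r k)))"
      using ip jk by simp
    also have "\<dots> = 1\<^sub>m n $$ (j, k)"
    proof (cases "j = k")
      case True
      have "complex_of_real (sqrt (r j)) * complex_of_real (sqrt (r j)) = complex_of_real (r j)"
        using r0[OF jk(1)] by (simp flip: of_real_mult)
      moreover have "complex_of_real (r j) \<noteq> 0" using r0[OF jk(1)] by simp
      ultimately show ?thesis
        using True jk by (simp flip: rip)
    next
      case False
      thus ?thesis using corthogonalD[OF ws(2), of k j] ws(3) jk by auto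
    qed
    finally show "(dagger W * W) $$ (j, k) = 1\<^sub>m n $$ (j, k)" .
  qed (use W in \<open>auto simp: dagger_def\<close>)
  moreover have "W * dagger W = 1\<^sub>m n"
    by (rule mat_mult_left_right_inverse[OF dagger_carrier[OF W] W WW])
  moreover have "col W 0 = (1 / complex_of_real (sqrt (r 0))) \<cdot>\<^sub>v v"
    using n v ws0 by (intro eq_vecI) (auto simp: W_def)
  ultimately show ?thesis using that W by blast
qed

text \<open>Deflation: a unitary \<open>W\<close> whose first column is an eigenvector turns
  \<open>A\<close> into a block matrix with a 1 by 1 block and a smaller Hermitian block, to which
  the induction hypothesis applies.\<close>

lemma spectral_decomposition:
  assumes "hermitian_mat n A"
  shows "\<exists>V (l :: nat \<Rightarrow> real). V \<in> carrier_mat n n \<and> dagger V * V = 1\<^sub>m n \<and>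
    A = V * mat n n (\<lambda>(i, j). if i = j then of_real (l i) else 0) * dagger V"
  using assms
proof (induction n arbitrary: A)
  case 0
  thus ?case
    by (intro exI[of _ "1\<^sub>m 0"]) (auto simp: hermitian_mat_def dagger_def intro!: eq_matI)
next
  case (Suc n)
  let ?n = "Suc n"
  have A: "A \<in> carrier_mat ?n ?n" and dA: "dagger A = A"
    using Suc.prems by (auto simp: hermitian_mat_iff_dagger)
  obtain e where "eigenvalue A e"
    using spectrum_non_empty[OF A] by (auto simp: spectrum_def)
  then obtain v where v: "v \<in> carrier_vec ?n" "v \<noteq> 0\<^sub>v ?n" "A *\<^sub>v v = e \<cdot>\<^sub>v v"
    using A by (auto simp: eigenvalue_def eigenvector_def)
  obtain W c where W: "W \<in> carrier_mat ?n ?n" "dagger W * W = 1\<^sub>m ?n" "W * dagger W = 1\<^sub>m ?n"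
    and c: "col W 0 = c \<cdot>\<^sub>v v"
    using exists_unitary_first_col[OF v(1,2)] by metis
  note dW = dagger_carrier[OF W(1)]
  define B where "B = dagger W * A * W"
  note mc = mult_carrier_mat[of _ ?n ?n _ ?n]
  have B: "B \<in> carrier_mat ?n ?n" unfolding B_def by (intro mc dW A W(1))
  have dB: "dagger B = B"
    unfolding B_def dagger_mult[OF mc[OF dW A] W(1)] dagger_mult[OF dW A] dA dagger_dagger
    by (rule assoc_mult_mat[OF dW A W(1), symmetric])
  have AB: "A = W * B * dagger W"
  proof -
    have "W * B * dagger W = W * (dagger W * (A * W)) * dagger W"
      unfolding B_def using assoc_mult_mat[OF dW A W(1)] by simp
    also have "\<dots> = (W * dagger W) * (A * W) * dagger W"
      using assoc_mult_mat[OF W(1) dW mc[OF A W(1)]] by simp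
    also have "\<dots> = A * W * dagger W" unfolding W(3) left_mult_one_mat[OF mc[OF A W(1)]] ..
    also have "\<dots> = A * (W * dagger W)" using assoc_mult_mat[OF A W(1) dW] by simp
    also have "\<dots> = A" unfolding W(3) by (rule right_mult_one_mat[OF A])
    finally show ?thesis by simp
  qed
  have B0: "B $$ (i, 0) = (if i = 0 then e else 0)" if "i < ?n" for i
  proof -
    have "col (A * W) 0 = A *\<^sub>v col W 0" using A W by (intro col_mult2) auto
    also have "\<dots> = e \<cdot>\<^sub>v col W 0"
      unfolding c using A v by (simp add: mult_mat_vec smult_smult_assoc mult.commute)
    finally have "col (A * W) 0 = e \<cdot>\<^sub>v col W 0" .
    hence ent: "(A * W) $$ (k, 0) = e * W $$ (k, 0)" if "k < ?n" for k
    proof -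
      have "(A * W) $$ (k, 0) = col (A * W) 0 $ k"
        using that A W(1) by (intro index_col[symmetric]) auto
      also have "\<dots> = e * W $$ (k, 0)"
        unfolding \<open>col (A * W) 0 = e \<cdot>\<^sub>v col W 0\<close> using that W(1) by simp
      finally show ?thesis .
    qed
    have "B $$ (i, 0) = (\<Sum>k<?n. dagger W $$ (i, k) * (A * W) $$ (k, 0))"
      unfolding B_def assoc_mult_mat[OF dW A W(1)]
      using that by (intro mult_index[OF dW mc[OF A W(1)]]) auto
    also have "\<dots> = e * (\<Sum>k<?n. dagger W $$ (i, k) * W $$ (k, 0))"
      unfolding sum_distrib_left using ent by (intro sum.cong) auto
    also have "(\<Sum>k<?n. dagger W $$ (i, k) * W $$ (k, 0)) = (dagger W * W) $$ (i, 0)"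
      using that by (intro mult_index[OF dW W(1), symmetric]) auto
    finally show ?thesis using W(2) that by simp
  qed
  \<comment> \<open>Symmetry transfers the zeros of the first column to the first row and makes the
    diagonal entry \<open>e\<close> real.\<close>
  have Bsym: "B $$ (i, j) = cnj (B $$ (j, i))" if "i < ?n" "j < ?n" for i j
    using dagger_index[OF B that] dB by simp
  have B0': "B $$ (0, i) = (if i = 0 then e else 0)" if "i < ?n" for i
  proof (cases "i = 0")
    case False
    thus ?thesis using Bsym[of 0 i] B0[OF that] that by simp
  qed (use B0[of 0] in simp)
  have e_real: "complex_of_real (Re e) = e"
  proof -
    have "e = cnj e" using Bsym[of 0 0, unfolded B0[OF zero_less_Suc]] by simp
    hence "Im e = Im (cnj e)" by (rule arg_cong)
    thus ?thesis by (simp add: complex_eq_iff)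
  qed
  define A3 where "A3 = mat n n (\<lambda>(i, j). B $$ (Suc i, Suc j))"
  have "hermitian_mat n A3"
    unfolding hermitian_mat_def A3_def by (auto intro: Bsym)
  from Suc.IH[OF this] obtain V3 l3 where V3: "V3 \<in> carrier_mat n n" "dagger V3 * V3 = 1\<^sub>m n"
    "A3 = V3 * mat n n (\<lambda>(i, j). if i = j then of_real (l3 i) else 0) * dagger V3" by blast
  \<comment> \<open>The block sum of the 1 by 1 identity and \<open>V3\<close>; it diagonalizes
    \<open>B\<close>, hence \<open>W * U\<close> diagonalizes \<open>A\<close>.\<close>
  define U where "U = mat ?n ?n (\<lambda>(i, j). case (i, j) of (0, 0) \<Rightarrow> 1
      | (Suc a, Suc b) \<Rightarrow> V3 $$ (a, b) | _ \<Rightarrow> 0)"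
  define l where "l i = (case i of 0 \<Rightarrow> Re e | Suc k \<Rightarrow> l3 k)" for i
  define L where "L = mat ?n ?n (\<lambda>(i, j). if i = j then complex_of_real (l i) else 0)"
  define L3 where "L3 = mat n n (\<lambda>(i, j). if i = j then complex_of_real (l3 i) else 0)"
  have U: "U \<in> carrier_mat ?n ?n" and L: "L \<in> carrier_mat ?n ?n"
    and L3: "L3 \<in> carrier_mat n n" by (auto simp: U_def L_def L3_def)
  have diag: "(X * mat m m (\<lambda>(i, j). if i = j then complex_of_real (f i) else 0) * dagger X) $$ (i, j)
      = (\<Sum>k<m. X $$ (i, k) * of_real (f k) * cnj (X $$ (j, k)))"
    if X: "X \<in> carrier_mat m m" and ij: "i < m" "j < m" for X m f i j
  proof -
    let ?D = "mat m m (\<lambda>(i, j). if i = j then complex_of_real (f i) else 0)"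
    have XD: "(X * ?D) $$ (i, k) = X $$ (i, k) * of_real (f k)" if "k < m" for k
      using that ij by (subst mult_index[OF X, of ?D m]) (auto simp: if_distrib cong: if_cong)
    show ?thesis
      using ij mult_carrier_mat[OF X, of ?D m] X
      by (subst mult_index[OF _ dagger_carrier[OF X]])
         (auto simp: XD simp del: index_mult_mat(1) intro!: sum.cong)
  qed
  have UU: "dagger U * U = 1\<^sub>m ?n"
  proof (rule eq_matI)
    fix i j assume "i < dim_row (1\<^sub>m ?n)" "j < dim_col (1\<^sub>m ?n)"
    hence ij: "i < ?n" "j < ?n" by auto
    have "(dagger U * U) $$ (i, j) = (\<Sum>k<?n. cnj (U $$ (k, i)) * U $$ (k, j))"
      using U ij by (subst mult_index[OF dagger_carrier[OF U] U]) auto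
    also have "\<dots> = 1\<^sub>m ?n $$ (i, j)"
    proof (cases "i = 0 \<or> j = 0")
      case True
      thus ?thesis using ij unfolding sum.lessThan_Suc_shift
        by (auto simp: U_def split: nat.splits)
    next
      case False
      then obtain a b where ab: "i = Suc a" "j = Suc b" by (metis not0_implies_Suc)
      have "(\<Sum>k<n. cnj (V3 $$ (k, a)) * V3 $$ (k, b)) = (dagger V3 * V3) $$ (a, b)"
        using ab ij V3 by (subst mult_index[OF dagger_carrier[OF V3(1)] V3(1)]) auto
      thus ?thesis using ij ab V3(2) unfolding sum.lessThan_Suc_shift
        by (auto simp: U_def)
    qed
    finally show "(dagger U * U) $$ (i, j) = 1\<^sub>m ?n $$ (i, j)" .
  qed (use U in \<open>auto simp: dagger_def\<close>)
  have BU: "B = U * L * dagger U"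
  proof (rule eq_matI)
    fix i j assume "i < dim_row (U * L * dagger U)" "j < dim_col (U * L * dagger U)"
    hence ij: "i < ?n" "j < ?n" using U by (auto simp: dagger_def)
    have R: "(U * L * dagger U) $$ (i, j) = (\<Sum>k<?n. U $$ (i, k) * of_real (l k) * cnj (U $$ (j, k)))"
      unfolding L_def by (rule diag[OF U ij])
    show "B $$ (i, j) = (U * L * dagger U) $$ (i, j)"
    proof (cases "i = 0 \<or> j = 0")
      case True
      thus ?thesis unfolding R sum.lessThan_Suc_shift using ij B0 B0' e_real
        by (auto simp: U_def l_def split: nat.splits)
    next
      case False
      then obtain a b where ab: "i = Suc a" "j = Suc b" by (metis not0_implies_Suc)
      have "B $$ (i, j) = A3 $$ (a, b)" using ab ij by (simp add: A3_def)
      also have "\<dots> = (\<Sum>k<n. V3 $$ (a, k) * of_real (l3 k) * cnj (V3 $$ (b, k)))"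
        unfolding V3(3) using ab ij by (intro diag[OF V3(1)]) auto
      finally show ?thesis unfolding R sum.lessThan_Suc_shift using ij ab
        by (auto simp: U_def l_def)
    qed
  qed (use B U in \<open>auto simp: dagger_def\<close>)
  note dU = dagger_carrier[OF U]
  have dWU: "dagger (W * U) = dagger U * dagger W" by (rule dagger_mult[OF W(1) U])
  have "dagger (W * U) * (W * U) = dagger U * (dagger W * (W * U))"
    unfolding dWU by (rule assoc_mult_mat[OF dU dW mc[OF W(1) U]])
  also have "dagger W * (W * U) = U"
    using assoc_mult_mat[OF dW W(1) U] W(2) U by simp
  finally have 1: "dagger (W * U) * (W * U) = 1\<^sub>m ?n" using UU by simp
  have "A = W * (U * L * dagger U) * dagger W" using AB BU by simp
  also have "U * L * dagger U = U * (L * dagger U)" by (rule assoc_mult_mat[OF U L dU])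
  also have "W * (U * (L * dagger U)) = W * U * (L * dagger U)"
    by (rule assoc_mult_mat[OF W(1) U mc[OF L dU], symmetric])
  also have "W * U * (L * dagger U) = W * U * L * dagger U"
    by (rule assoc_mult_mat[OF mc[OF W(1) U] L dU, symmetric])
  also have "\<dots> * dagger W = W * U * L * dagger (W * U)"
    unfolding dWU by (rule assoc_mult_mat[OF mc[OF mc[OF W(1) U] L] dU dW])
  finally have 2: "A = W * U * L * dagger (W * U)" .
  show ?case
    using 1 2 W(1) U unfolding L_def by (intro exI[of _ "W * U"] exI[of _ l]) simp
qed

lemma quadratic_form_eigenvector:
  assumes "v \<in> carrier_vec n" "A *\<^sub>v v = c \<cdot>\<^sub>v v"
  shows "conjugate v \<bullet> (A *\<^sub>v v) = c * (\<Sum>i<n. cnj (v $ i) * v $ i)"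
  unfolding assms(2) using assms(1)
  by (auto simp: scalar_prod_def lessThan_atLeast0 sum_distrib_left intro!: sum.cong)

text \<open>\<open>v k a\<close> is the component \<open>a\<close> of the \<open>k\<close>-th eigenvector, with eigenvalue \<open>l k\<close>. The eigenvector
  number \<open>z\<close> agrees with the target state only up to a phase, so only the projectors are compared.\<close>

locale verification =
  fixes D :: nat and \<psi> :: "complex vec" and \<Omega> :: "complex mat"
    and v :: "nat \<Rightarrow> nat \<Rightarrow> complex" and l :: "nat \<Rightarrow> real" and z :: nat
  assumes orthonormal: "\<And>j k. j < D \<Longrightarrow> k < D \<Longrightarrow>
      (\<Sum>a<D. cnj (v j a) * v k a) = (if j = k then 1 else 0)"
    and complete: "\<And>a b. a < D \<Longrightarrow> b < D \<Longrightarrow>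
      (\<Sum>k<D. v k a * cnj (v k b)) = (if a = b then 1 else 0)"
    and Omega_carrier: "\<Omega> \<in> carrier_mat D D"
    and Omega_index: "\<And>a b. a < D \<Longrightarrow> b < D \<Longrightarrow>
      \<Omega> $$ (a, b) = (\<Sum>k<D. of_real (l k) * (v k a * cnj (v k b)))"
    and z: "z < D" "l z = 1"
    and psi_index: "\<And>a b. a < D \<Longrightarrow> b < D \<Longrightarrow> \<psi> $ a * cnj (\<psi> $ b) = v z a * cnj (v z b)"

text \<open>The link between \<nu> and \<tau>, defined through sets of eigenvalues, and the family
  \<open>l\<close> indexed with multiplicity. It needs that the two give the same values and that 1
  occurs in \<open>l\<close> only at \<open>z\<close>.\<close>

lemma verif_op_spectrum:
  assumes "D \<ge> 2" and psi: "unit_vec_c D \<psi>" and ver: "verif_op D \<psi> \<Omega>"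
  obtains v l z where "verification D \<psi> \<Omega> v l z"
    "\<And>k. k < D \<Longrightarrow> k \<noteq> z \<Longrightarrow> tau_op \<Omega> \<le> l k \<and> l k \<le> 1 - nu_op \<Omega>"
    "0 < nu_op \<Omega>" "nu_op \<Omega> \<le> 1" "0 \<le> tau_op \<Omega>" "nu_op \<Omega> + tau_op \<Omega> \<le> 1"
proof -
  have psi_c: "\<psi> \<in> carrier_vec D" and psi_n: "(\<Sum>i<D. cnj (\<psi> $ i) * \<psi> $ i) = 1"
  proof -
    show "\<psi> \<in> carrier_vec D" using psi by (simp add: unit_vec_c_def)
    have "(\<Sum>i<D. cnj (\<psi> $ i) * \<psi> $ i) = of_real (\<Sum>i<D. (cmod (\<psi> $ i))\<^sup>2)"
      unfolding of_real_sum by (intro sum.cong refl) (simp only: complex_norm_square mult.commute)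
    also have "(\<Sum>i<D. (cmod (\<psi> $ i))\<^sup>2) = 1" using psi by (simp add: unit_vec_c_def)
    finally show "(\<Sum>i<D. cnj (\<psi> $ i) * \<psi> $ i) = 1" by simp
  qed
  have herm: "hermitian_mat D \<Omega>" and psd: "psd_mat D \<Omega>" "psd_mat D (1\<^sub>m D - \<Omega>)"
    and ev_psi: "\<Omega> *\<^sub>v \<psi> = \<psi>" and simple: "\<And>u. eigenvector \<Omega> u 1 \<Longrightarrow> \<exists>c. u = c \<cdot>\<^sub>v \<psi>"
    using ver by (auto simp: verif_op_def)
  have Om: "\<Omega> \<in> carrier_mat D D" using herm by (simp add: hermitian_mat_def)
  obtain V l where V: "V \<in> carrier_mat D D" "dagger V * V = 1\<^sub>m D"
    and OV: "\<Omega> = V * mat D D (\<lambda>(i, j). if i = j then of_real (l i) else 0) * dagger V"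
    using spectral_decomposition[OF herm] by blast
  define v where "v k a = V $$ (a, k)" for k a
  note dV = dagger_carrier[OF V(1)]
  have orth: "(\<Sum>i<D. cnj (v j i) * v k i) = (if j = k then 1 else 0)" if "j < D" "k < D" for j k
    using mult_index[OF dV V(1) that] V that by (simp add: v_def)
  have compl: "(\<Sum>k<D. v k a * cnj (v k b)) = (if a = b then 1 else 0)" if "a < D" "b < D" for a b
    using mult_index[OF V(1) dV that] V(1) that mat_mult_left_right_inverse[OF dV V]
    by (simp add: v_def)
  have Oi: "\<Omega> $$ (a, b) = (\<Sum>k<D. of_real (l k) * (v k a * cnj (v k b)))"
    if "a < D" "b < D" for a b
  proof -
    let ?L = "mat D D (\<lambda>(i, j). if i = j then complex_of_real (l i) else 0)"
    have VL: "(V * ?L) $$ (a, k) = V $$ (a, k) * of_real (l k)" if "k < D" for k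
      using that \<open>a < D\<close> by (subst mult_index[OF V(1), of ?L D]) (auto simp: if_distrib cong: if_cong)
    have "\<Omega> $$ (a, b) = (\<Sum>k<D. (V * ?L) $$ (a, k) * dagger V $$ (k, b))"
      unfolding OV by (rule mult_index[OF _ dV that]) (use V(1) in simp)
    also have "\<dots> = (\<Sum>k<D. of_real (l k) * (v k a * cnj (v k b)))"
      using VL V(1) that by (intro sum.cong) (auto simp: v_def simp del: index_mult_mat(1))
    finally show ?thesis .
  qed
  have colv: "col V k \<in> carrier_vec D" "col V k \<noteq> 0\<^sub>v D" "\<Omega> *\<^sub>v col V k = of_real (l k) \<cdot>\<^sub>v col V k"
    if k: "k < D" for k
  proof -
    show c: "col V k \<in> carrier_vec D" using V(1) k by auto
    have ci: "col V k $ i = v k i" if "i < D" for i using V(1) k that by (simp add: v_def)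
    show "col V k \<noteq> 0\<^sub>v D"
    proof
      assume "col V k = 0\<^sub>v D"
      hence "v k i = 0" if "i < D" for i using ci[OF that] that by simp
      thus False using orth[OF k k] by simp
    qed
    show "\<Omega> *\<^sub>v col V k = of_real (l k) \<cdot>\<^sub>v col V k"
    proof (rule eq_vecI)
      fix a assume "a < dim_vec (of_real (l k) \<cdot>\<^sub>v col V k)"
      hence a: "a < D" using V(1) by simp
      have "(\<Omega> *\<^sub>v col V k) $ a = (\<Sum>b<D. \<Omega> $$ (a, b) * v k b)"
        unfolding mult_vec_index[OF Om c a] using ci by simp
      also have "\<dots> = (\<Sum>b<D. \<Sum>m<D. of_real (l m) * v m a * (cnj (v m b) * v k b))"
        using Oi[OF a] by (intro sum.cong) (auto simp: sum_distrib_right sum_distrib_left mult_ac)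
      also have "\<dots> = (\<Sum>m<D. of_real (l m) * v m a * (\<Sum>b<D. cnj (v m b) * v k b))"
        unfolding sum_distrib_left by (rule sum.swap)
      also have "\<dots> = (\<Sum>m<D. if m = k then of_real (l k) * v k a else 0)"
        using k by (intro sum.cong) (auto simp: orth)
      also have "\<dots> = of_real (l k) * v k a" using k by simp
      finally show "(\<Omega> *\<^sub>v col V k) $ a = (of_real (l k) \<cdot>\<^sub>v col V k) $ a"
        using a ci[OF a] V(1) by simp
    qed (use Om V(1) in auto)
  qed
  have coli: "col V k $ i = v k i" if "i < D" "k < D" for k i using V(1) that by (simp add: v_def)
  have evk: "eigenvector \<Omega> (col V k) (of_real (l k))" if "k < D" for k
    unfolding eigenvector_def using colv[OF that] Om by auto
  \<comment> \<open>An eigenvector has some nonzero coefficient \<open>c m\<close> in the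
    orthonormal basis; comparing that coefficient on both sides of the eigenvalue equation gives
    \<open>e = l m\<close>.\<close>
  have ev_l: "\<exists>m<D. e = of_real (l m)" if "eigenvalue \<Omega> e" for e
  proof -
    obtain w where w: "w \<in> carrier_vec D" "w \<noteq> 0\<^sub>v D" "\<Omega> *\<^sub>v w = e \<cdot>\<^sub>v w"
      using \<open>eigenvalue \<Omega> e\<close> Om by (auto simp: eigenvalue_def eigenvector_def)
    define c where "c m = (\<Sum>b<D. cnj (v m b) * w $ b)" for m
    have expand: "w $ a = (\<Sum>m<D. v m a * c m)" if a: "a < D" for a
    proof -
      have "(\<Sum>m<D. v m a * c m) = (\<Sum>m<D. \<Sum>b<D. v m a * cnj (v m b) * w $ b)"
        unfolding c_def sum_distrib_left by (simp add: mult.assoc)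
      also have "\<dots> = (\<Sum>b<D. \<Sum>m<D. v m a * cnj (v m b) * w $ b)" by (rule sum.swap)
      also have "\<dots> = (\<Sum>b<D. if b = a then w $ b else 0)"
        unfolding sum_distrib_right[symmetric] using a by (intro sum.cong) (auto simp: compl)
      finally show ?thesis using a by simp
    qed
    have "\<exists>m<D. c m \<noteq> 0"
    proof (rule ccontr)
      assume "\<not> (\<exists>m<D. c m \<noteq> 0)"
      hence "w = 0\<^sub>v D" using w(1) expand by (intro eq_vecI) auto
      thus False using w(2) by simp
    qed
    then obtain m where m: "m < D" "c m \<noteq> 0" by blast
    have "e * w $ a = (\<Sum>k<D. of_real (l k) * v k a * c k)" if a: "a < D" for a
    proof -
      have "e * w $ a = (\<Omega> *\<^sub>v w) $ a" using w a by simp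
      also have "\<dots> = (\<Sum>b<D. \<Sum>k<D. of_real (l k) * v k a * (cnj (v k b) * w $ b))"
        unfolding mult_vec_index[OF Om w(1) a]
        using Oi[OF a] by (intro sum.cong) (auto simp: sum_distrib_right sum_distrib_left mult_ac)
      also have "\<dots> = (\<Sum>k<D. of_real (l k) * v k a * c k)"
        unfolding c_def sum_distrib_left by (rule sum.swap)
      finally show ?thesis .
    qed
    hence "(\<Sum>a<D. cnj (v m a) * (e * w $ a))
        = (\<Sum>a<D. \<Sum>k<D. of_real (l k) * c k * (cnj (v m a) * v k a))"
      by (intro sum.cong) (auto simp: sum_distrib_left algebra_simps)
    also have "\<dots> = (\<Sum>k<D. of_real (l k) * c k * (\<Sum>a<D. cnj (v m a) * v k a))"
      unfolding sum_distrib_left by (rule sum.swap)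
    also have "\<dots> = (\<Sum>k<D. if k = m then of_real (l m) * c m else 0)"
      using m by (intro sum.cong) (auto simp: orth)
    also have "\<dots> = of_real (l m) * c m" using m by simp
    also have "(\<Sum>a<D. cnj (v m a) * (e * w $ a)) = e * c m"
      unfolding c_def sum_distrib_left by (simp add: algebra_simps)
    finally show ?thesis using m by auto
  qed
  have nrm: "(\<Sum>i<D. cnj (col V k $ i) * col V k $ i) = 1" if "k < D" for k
    using orth[OF that that] coli[OF _ that] by simp
  have l0: "0 \<le> l k" if "k < D" for k
    using psd(1) colv(1)[OF that] quadratic_form_eigenvector[OF colv(1,3)[OF that]] nrm[OF that]
    by (auto simp: psd_mat_def)
  have l1: "l k \<le> 1" if "k < D" for k
  proof -
    have "(1\<^sub>m D - \<Omega>) *\<^sub>v col V k = col V k - of_real (l k) \<cdot>\<^sub>v col V k"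
      using colv[OF that] Om by (simp add: minus_mult_distrib_mat_vec[of _ D D])
    also have "\<dots> = of_real (1 - l k) \<cdot>\<^sub>v col V k"
      using V(1) by (intro eq_vecI) (auto simp: algebra_simps)
    finally have eq: "(1\<^sub>m D - \<Omega>) *\<^sub>v col V k = of_real (1 - l k) \<cdot>\<^sub>v col V k" .
    have "conjugate (col V k) \<bullet> ((1\<^sub>m D - \<Omega>) *\<^sub>v col V k) = of_real (1 - l k)"
      unfolding quadratic_form_eigenvector[OF colv(1)[OF that] eq] nrm[OF that] by (rule mult_1_right)
    hence "Re (conjugate (col V k) \<bullet> ((1\<^sub>m D - \<Omega>) *\<^sub>v col V k)) = 1 - l k" by simp
    thus ?thesis using psd(2) colv(1)[OF that] by (auto simp: psd_mat_def)
  qed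
  have "\<psi> \<noteq> 0\<^sub>v D" using psi_n by auto
  hence "eigenvalue \<Omega> 1"
    unfolding eigenvalue_def eigenvector_def using psi_c Om ev_psi by (intro exI[of _ \<psi>]) auto
  from ev_l[OF this] obtain z where z: "z < D" "l z = 1" by (metis of_real_eq_1_iff)
  have multiple: "\<exists>c. c \<noteq> 0 \<and> (\<forall>i<D. v k i = c * \<psi> $ i)" if k: "k < D" "l k = 1" for k
  proof -
    obtain c where c: "col V k = c \<cdot>\<^sub>v \<psi>" using simple[of "col V k"] evk[OF k(1)] k(2) by auto
    hence "v k i = c * \<psi> $ i" if "i < D" for i using coli[OF that k(1)] that psi_c by simp
    moreover have "c \<noteq> 0" using c colv(2)[OF k(1)] psi_c by auto
    ultimately show ?thesis by blast
  qed
  obtain c where c: "c \<noteq> 0" "\<And>i. i < D \<Longrightarrow> v z i = c * \<psi> $ i" using multiple[OF z] by auto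
  have ip: "(\<Sum>i<D. cnj (a * \<psi> $ i) * (b * \<psi> $ i)) = cnj a * b" for a b
  proof -
    have "(\<Sum>i<D. cnj (a * \<psi> $ i) * (b * \<psi> $ i)) = (\<Sum>i<D. cnj a * b * (cnj (\<psi> $ i) * \<psi> $ i))"
      by (intro sum.cong) (auto simp: algebra_simps)
    also have "\<dots> = cnj a * b" unfolding sum_distrib_left[symmetric] psi_n by simp
    finally show ?thesis .
  qed
  have cc: "cnj c * c = 1" using orth[OF z(1) z(1)] ip[of c c] c(2) by simp
  \<comment> \<open>Nondegeneracy makes every eigenvector for 1 a multiple of \<psi>, and two
    nonzero multiples cannot be orthogonal.\<close>
  have l_ne: "l k \<noteq> 1" if k: "k < D" "k \<noteq> z" for k
  proof
    assume "l k = 1"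
    then obtain c' where c': "c' \<noteq> 0" "\<And>i. i < D \<Longrightarrow> v k i = c' * \<psi> $ i"
      using multiple[OF k(1)] by auto
    have "cnj c * c' = 0" using orth[OF z(1) k(1)] ip[of c c'] c(2) c'(2) k(2) by simp
    thus False using c c' by simp
  qed
  have all: "{Re k | k. eigenvalue \<Omega> k} = l ` {..<D}"
  proof (intro equalityI subsetI)
    fix x assume "x \<in> {Re k | k. eigenvalue \<Omega> k}"
    then obtain k where k: "x = Re k" "eigenvalue \<Omega> k" by blast
    from ev_l[OF k(2)] obtain m where "m < D" "k = of_real (l m)" by blast
    thus "x \<in> l ` {..<D}" using k by auto
  next
    fix x assume "x \<in> l ` {..<D}"
    then obtain m where m: "m < D" "x = l m" by blast
    have "eigenvalue \<Omega> (of_real (l m))" using evk[OF m(1)] unfolding eigenvalue_def by blast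
    moreover have "x = Re (of_real (l m))" using m by simp
    ultimately show "x \<in> {Re k | k. eigenvalue \<Omega> k}" by blast
  qed
  have rest: "{Re k | k. eigenvalue \<Omega> k \<and> k \<noteq> 1} = l ` ({..<D} - {z})"
  proof (intro equalityI subsetI)
    fix x assume "x \<in> {Re k | k. eigenvalue \<Omega> k \<and> k \<noteq> 1}"
    then obtain k where k: "x = Re k" "eigenvalue \<Omega> k" "k \<noteq> 1" by blast
    from ev_l[OF k(2)] obtain m where "m < D" "k = of_real (l m)" by blast
    thus "x \<in> l ` ({..<D} - {z})" using k z by auto
  next
    fix x assume "x \<in> l ` ({..<D} - {z})"
    then obtain m where m: "m < D" "m \<noteq> z" "x = l m" by blast
    have "eigenvalue \<Omega> (of_real (l m))" using evk[OF m(1)] unfolding eigenvalue_def by blast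
    moreover have "x = Re (of_real (l m))" "complex_of_real (l m) \<noteq> 1"
      using m l_ne[OF m(1,2)] by simp_all
    ultimately show "x \<in> {Re k | k. eigenvalue \<Omega> k \<and> k \<noteq> 1}" by blast
  qed
  \<comment> \<open>A second index exists because the dimension is at least 2; it keeps the set
    under \<open>Max\<close> nonempty.\<close>
  obtain k0 where k0: "k0 < D" "k0 \<noteq> z"
    using \<open>D \<ge> 2\<close> that[of "if z = 0 then 1 else 0"] by (auto split: if_splits)
  have beta_in: "beta_op \<Omega> \<in> l ` ({..<D} - {z})"
    unfolding beta_op_def rest using k0 by (intro Max_in) auto
  have tau_in: "tau_op \<Omega> \<in> l ` {..<D}"
    unfolding tau_op_def all using k0 by (intro Min_in) auto
  have le: "l k \<le> beta_op \<Omega>" if "k < D" "k \<noteq> z" for k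
    unfolding beta_op_def rest using that by (intro Max_ge) auto
  have ge: "tau_op \<Omega> \<le> l k" if "k < D" for k
    unfolding tau_op_def all using that by (intro Min_le) auto
  have "verification D \<psi> \<Omega> v l z"
  proof
    fix a b assume ab: "a < D" "b < D"
    have "v z a * cnj (v z b) = (cnj c * c) * (\<psi> $ a * cnj (\<psi> $ b))"
      using c(2) ab by simp
    thus "\<psi> $ a * cnj (\<psi> $ b) = v z a * cnj (v z b)" using cc by simp
  qed (use orth compl Om Oi z in auto)
  moreover have "tau_op \<Omega> \<le> l k \<and> l k \<le> 1 - nu_op \<Omega>" if "k < D" "k \<noteq> z" for k
    using le[OF that] ge[OF that(1)] by (simp add: nu_op_def)
  moreover have "0 < nu_op \<Omega>" "nu_op \<Omega> \<le> 1"
  proof -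
    obtain m where m: "m < D" "m \<noteq> z" "beta_op \<Omega> = l m" using beta_in by blast
    show "0 < nu_op \<Omega>" "nu_op \<Omega> \<le> 1"
      using l1[OF m(1)] l_ne[OF m(1,2)] l0[OF m(1)] m(3) by (auto simp: nu_op_def)
  qed
  moreover have "0 \<le> tau_op \<Omega>" using tau_in l0 by auto
  moreover have "nu_op \<Omega> + tau_op \<Omega> \<le> 1" using beta_in ge by (auto simp: nu_op_def)
  ultimately show ?thesis using that by blast
qed

section \<open>Digits and permutations of tensor factors\<close>

lemma sum_digits_less:
  fixes f :: "nat \<Rightarrow> nat"
  assumes "\<And>i. i < n \<Longrightarrow> f i < D"
  shows "(\<Sum>i<n. f i * D ^ i) < D ^ n"
  using assms
proof (induction n)
  case (Suc n)
  have "Suc (f n) * D ^ n \<le> D * D ^ n" using Suc.prems[of n] by (intro mult_right_mono) auto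
  moreover have "(\<Sum>i<n. f i * D ^ i) < D ^ n" using Suc by simp
  ultimately show ?case by simp
qed simp

lemma digit_sum_digits:
  assumes "\<And>i. i < n \<Longrightarrow> f i < D" "j < n"
  shows "digit D j (\<Sum>i<n. f i * D ^ i) = f j"
  using assms
proof (induction n)
  case (Suc n)
  let ?S = "\<Sum>i<n. f i * D ^ i"
  have D0: "0 < D" using Suc.prems(1)[of n] by simp
  have less: "?S < D ^ n" using Suc.prems by (intro sum_digits_less) auto
  show ?case
  proof (cases "j = n")
    case True
    thus ?thesis using less Suc.prems(1)[of n] by (simp add: digit_def)
  next
    case False
    hence j: "j < n" using Suc.prems by simp
    \<comment> \<open>After division by \<open>D ^ j\<close> the leading digit contributes a
      multiple of \<open>D\<close>, which vanishes modulo \<open>D\<close>.\<close>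
    then obtain k where k: "n = Suc (j + k)" using less_iff_Suc_add by blast
    have "D ^ n = D ^ j * (D * D ^ k)" unfolding k by (simp add: power_add)
    hence "?S + f n * D ^ n = ?S + D ^ j * (D * (D ^ k * f n))" by (simp add: mult_ac)
    hence "(?S + f n * D ^ n) div D ^ j = D * (D ^ k * f n) + ?S div D ^ j"
      using D0 by (simp only: div_mult_self2) simp
    hence "digit D j (?S + f n * D ^ n) = digit D j ?S" by (simp add: digit_def)
    thus ?thesis using Suc j by simp
  qed
qed simp

lemma sum_digits_mod: "(\<Sum>i<n. digit D i x * D ^ i) = x mod D ^ n"
proof (induction n)
  case (Suc n)
  have "x mod (D ^ n * D) = D ^ n * (x div D ^ n mod D) + x mod D ^ n"
    by (rule mod_mult2_eq)
  thus ?case using Suc by (simp add: digit_def mult.commute)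
qed simp

lemma sum_digits: "x < D ^ n \<Longrightarrow> (\<Sum>i<n. digit D i x * D ^ i) = x"
  by (simp add: sum_digits_mod)

lemma digit_less: "0 < D \<Longrightarrow> digit D i x < D"
  by (simp add: digit_def)

text \<open>The extensional product fixes the values outside the positions, so that words correspond
  one to one to basis indices and form a finite set.\<close>

abbreviation words :: "nat \<Rightarrow> nat \<Rightarrow> (nat \<Rightarrow> nat) set" where
  "words D n \<equiv> PiE {..<n} (\<lambda>_. {..<D})"

lemma finite_words: "finite (words D n)"
  by (intro finite_PiE) auto

lemma bij_betw_digits:
  assumes "0 < D"
  shows "bij_betw (\<lambda>x. restrict (\<lambda>i. digit D i x) {..<n}) {..<D ^ n} (words D n)"
proof (rule bij_betw_byWitness[where f' = "\<lambda>f. \<Sum>i<n. f i * D ^ i"])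
  show "\<forall>x\<in>{..<D ^ n}. (\<Sum>i<n. restrict (\<lambda>i. digit D i x) {..<n} i * D ^ i) = x"
    using sum_digits by auto
  show "\<forall>f\<in>words D n. restrict (\<lambda>i. digit D i (\<Sum>i<n. f i * D ^ i)) {..<n} = f"
  proof
    fix f assume f: "f \<in> words D n"
    have "restrict (\<lambda>i. digit D i (\<Sum>i<n. f i * D ^ i)) {..<n} i = f i" for i
    proof (cases "i < n")
      case True
      have "digit D i (\<Sum>i<n. f i * D ^ i) = f i"
        using f True by (intro digit_sum_digits[where f = f]) auto
      thus ?thesis using True by simp
    next
      case False
      thus ?thesis using PiE_arb[OF f] by simp
    qed
    thus "restrict (\<lambda>i. digit D i (\<Sum>i<n. f i * D ^ i)) {..<n} = f" by (rule ext)
  qed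
  show "(\<lambda>x. restrict (\<lambda>i. digit D i x) {..<n}) ` {..<D ^ n} \<subseteq> words D n"
    using digit_less[OF assms] by (auto simp: PiE_iff extensional_def split: if_splits)
  show "(\<lambda>f. \<Sum>i<n. f i * D ^ i) ` words D n \<subseteq> {..<D ^ n}"
    by (auto intro!: sum_digits_less)
qed

lemma digits_eq_iff:
  assumes "x < D ^ n" "y < D ^ n"
  shows "(\<forall>i<n. digit D i x = digit D i y) \<longleftrightarrow> x = y"
proof
  assume "\<forall>i<n. digit D i x = digit D i y"
  hence "(\<Sum>i<n. digit D i x * D ^ i) = (\<Sum>i<n. digit D i y * D ^ i)" by (intro sum.cong) auto
  thus "x = y" using sum_digits[OF assms(1)] sum_digits[OF assms(2)] by simp
qed simp

text \<open>The distributive law read through base-\<open>D\<close> digits: the inner product of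
  product vectors is the product of the inner products of the factors.\<close>

lemma sum_prod_digits:
  fixes g :: "nat \<Rightarrow> nat \<Rightarrow> 'a :: comm_semiring_1"
  assumes "0 < D"
  shows "(\<Sum>x<D ^ n. \<Prod>i<n. g i (digit D i x)) = (\<Prod>i<n. \<Sum>a<D. g i a)"
proof -
  have "(\<Prod>i<n. \<Sum>a<D. g i a) = (\<Sum>f\<in>words D n. \<Prod>i<n. g i (f i))"
    by (rule prod_sum_PiE) auto
  also have "\<dots> = (\<Sum>x<D ^ n. \<Prod>i<n. g i (restrict (\<lambda>i. digit D i x) {..<n} i))"
    by (rule sum.reindex_bij_betw[OF bij_betw_digits[OF assms], symmetric])
  also have "\<dots> = (\<Sum>x<D ^ n. \<Prod>i<n. g i (digit D i x))" by simp
  finally show ?thesis ..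
qed

lemma perm_idx_less:
  assumes "0 < D"
  shows "perm_idx D n \<pi> x < D ^ n"
  unfolding perm_idx_def using digit_less[OF assms] by (intro sum_digits_less)

lemma digit_perm_idx:
  assumes "0 < D" "i < n"
  shows "digit D i (perm_idx D n \<pi> x) = digit D (\<pi> i) x"
  unfolding perm_idx_def using digit_less[OF assms(1)] assms(2)
  by (intro digit_sum_digits[where f = "\<lambda>i. digit D (\<pi> i) x"])

lemma bij_betw_perm_idx:
  assumes "0 < D" "\<pi> permutes {..<n}"
  shows "bij_betw (perm_idx D n \<pi>) {..<D ^ n} {..<D ^ n}"
proof -
  have "inj_on (perm_idx D n \<pi>) {..<D ^ n}"
  proof (rule inj_onI)
    fix x y assume xy: "x \<in> {..<D ^ n}" "y \<in> {..<D ^ n}" "perm_idx D n \<pi> x = perm_idx D n \<pi> y"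
    have "digit D i x = digit D i y" if "i < n" for i
    proof -
      have "i \<in> \<pi> ` {..<n}" using permutes_image[OF assms(2)] that by simp
      then obtain j where j: "j < n" "\<pi> j = i" by auto
      have "digit D (\<pi> j) x = digit D (\<pi> j) y"
        using digit_perm_idx[OF assms(1) j(1), of \<pi> x] digit_perm_idx[OF assms(1) j(1), of \<pi> y] xy(3)
        by simp
      thus ?thesis using j by simp
    qed
    thus "x = y" using digits_eq_iff[of x D n y] xy by simp
  qed
  moreover have "perm_idx D n \<pi> ` {..<D ^ n} \<subseteq> {..<D ^ n}"
    using perm_idx_less[OF assms(1)] by auto
  ultimately show ?thesis
    by (simp add: bij_betw_def endo_inj_surj)
qed

text \<open>Multiplying by the permutation matrix relabels rows on the left and columns on the
  right. As the relabelling is bijective, commuting means that relabelling both at once changes no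
  entry.\<close>

lemma perm_op_commute_iff:
  assumes "0 < D" "\<pi> permutes {..<n}" "\<rho> \<in> carrier_mat (D ^ n) (D ^ n)"
  shows "perm_op D n \<pi> * \<rho> = \<rho> * perm_op D n \<pi> \<longleftrightarrow>
    (\<forall>r<D ^ n. \<forall>c<D ^ n. \<rho> $$ (perm_idx D n \<pi> r, perm_idx D n \<pi> c) = \<rho> $$ (r, c))"
proof -
  let ?s = "perm_idx D n \<pi>" and ?d = "D ^ n" and ?P = "perm_op D n \<pi>"
  have P: "?P \<in> carrier_mat ?d ?d" by (simp add: perm_op_def)
  note bij = bij_betw_perm_idx[OF assms(1,2)]
  note sl = perm_idx_less[OF assms(1), of n \<pi>]
  have inj: "?s a = ?s b \<longleftrightarrow> a = b" if "a < ?d" "b < ?d" for a b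
    using bij that by (auto simp: bij_betw_def inj_on_def)
  have Pr: "(?P * \<rho>) $$ (?s r, c) = \<rho> $$ (r, c)" if "r < ?d" "c < ?d" for r c
  proof -
    have "(?P * \<rho>) $$ (?s r, c) = (\<Sum>k<?d. (if k = r then \<rho> $$ (r, c) else 0))"
      unfolding mult_index[OF P assms(3) sl that(2)] using that sl
      by (intro sum.cong) (auto simp: perm_op_def inj)
    thus ?thesis using that by simp
  qed
  have rP: "(\<rho> * ?P) $$ (r, c) = \<rho> $$ (r, ?s c)" if "r < ?d" "c < ?d" for r c
  proof -
    have "(\<rho> * ?P) $$ (r, c) = (\<Sum>k<?d. (if k = ?s c then \<rho> $$ (r, ?s c) else 0))"
      unfolding mult_index[OF assms(3) P that] using that
      by (intro sum.cong) (auto simp: perm_op_def)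
    thus ?thesis using that sl by simp
  qed
  show ?thesis
  proof
    assume eq: "?P * \<rho> = \<rho> * ?P"
    show "\<forall>r<?d. \<forall>c<?d. \<rho> $$ (?s r, ?s c) = \<rho> $$ (r, c)"
    proof (intro allI impI)
      fix r c assume "r < ?d" "c < ?d"
      thus "\<rho> $$ (?s r, ?s c) = \<rho> $$ (r, c)"
        using Pr[of r c] rP[OF sl, of c r] unfolding eq by simp
    qed
  next
    assume eq: "\<forall>r<?d. \<forall>c<?d. \<rho> $$ (?s r, ?s c) = \<rho> $$ (r, c)"
    show "?P * \<rho> = \<rho> * ?P"
    proof (rule eq_matI)
      fix r' c assume "r' < dim_row (\<rho> * ?P)" "c < dim_col (\<rho> * ?P)"
      hence rc: "r' < ?d" "c < ?d" using P assms(3) by auto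
      obtain r where r: "r < ?d" "r' = ?s r"
        using bij rc(1) unfolding bij_betw_def by (metis imageE lessThan_iff)
      have "(?P * \<rho>) $$ (r', c) = \<rho> $$ (r, c)" unfolding r(2) by (rule Pr[OF r(1) rc(2)])
      also have "\<dots> = \<rho> $$ (r', ?s c)" unfolding r(2) using eq r(1) rc(2) by simp
      also have "\<dots> = (\<rho> * ?P) $$ (r', c)" by (rule rP[OF rc, symmetric])
      finally show "(?P * \<rho>) $$ (r', c) = (\<rho> * ?P) $$ (r', c)" .
    qed (use P assms(3) in auto)
  qed
qed

lemma mtrace_mult:
  assumes "A \<in> carrier_mat n n" "B \<in> carrier_mat n n"
  shows "mtrace (A * B) = (\<Sum>r<n. \<Sum>c<n. A $$ (r, c) * B $$ (c, r))"
proof -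
  have "mtrace (A * B) = (\<Sum>r<n. (A * B) $$ (r, r))" using assms by (simp add: mtrace_def)
  also have "\<dots> = (\<Sum>r<n. \<Sum>c<n. A $$ (r, c) * B $$ (c, r))"
    by (intro sum.cong refl mult_index[OF assms]) auto
  finally show ?thesis .
qed

section \<open>Permutation-invariant states in the eigenbasis\<close>

context verification
begin

lemma D_pos: "0 < D" using z by simp

text \<open>Components of the tensor product of the eigenvectors named by the letters of the word
  \<open>x\<close>.\<close>

definition vec_at :: "nat \<Rightarrow> (nat \<Rightarrow> nat) \<Rightarrow> nat \<Rightarrow> complex" where
  "vec_at n x r = (\<Prod>i<n. v (x i) (digit D i r))"

text \<open>The diagonal matrix element of \<rho> at that product vector. For a density operator
  this is the probability of the word \<open>x\<close>.\<close>

definition weight :: "nat \<Rightarrow> complex mat \<Rightarrow> (nat \<Rightarrow> nat) \<Rightarrow> real" where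
  "weight n \<rho> x = Re (\<Sum>r<D ^ n. \<Sum>c<D ^ n. vec_at n x r * cnj (vec_at n x c) * \<rho> $$ (c, r))"

lemma weight_nonneg:
  assumes "psd_mat (D ^ n) \<rho>"
  shows "0 \<le> weight n \<rho> x"
proof -
  let ?u = "vec (D ^ n) (vec_at n x)"
  have \<rho>: "\<rho> \<in> carrier_mat (D ^ n) (D ^ n)"
    using assms by (simp add: psd_mat_def hermitian_mat_def)
  have "conjugate ?u \<bullet> (\<rho> *\<^sub>v ?u) = (\<Sum>c<D ^ n. cnj (vec_at n x c) * (\<rho> *\<^sub>v ?u) $ c)"
    using \<rho> by (auto simp: scalar_prod_def lessThan_atLeast0 intro!: sum.cong)
  also have "\<dots> = (\<Sum>c<D ^ n. \<Sum>r<D ^ n. vec_at n x r * cnj (vec_at n x c) * \<rho> $$ (c, r))"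
    using mult_vec_index[OF \<rho>, of ?u]
    by (intro sum.cong) (auto simp: sum_distrib_left mult_ac simp del: index_mult_mat_vec)
  also have "\<dots> = (\<Sum>r<D ^ n. \<Sum>c<D ^ n. vec_at n x r * cnj (vec_at n x c) * \<rho> $$ (c, r))"
    by (rule sum.swap)
  finally have "weight n \<rho> x = Re (conjugate ?u \<bullet> (\<rho> *\<^sub>v ?u))"
    by (simp add: weight_def)
  thus ?thesis using assms by (simp add: psd_mat_def)
qed

text \<open>\<open>T\<close> is a tensor product of operators diagonal in the common eigenbasis, so
  expanding the product of sums leaves only diagonal elements of \<rho>. The eigenvalues
  \<open>w\<close> depend on the factor because the last factor differs from the tests.\<close>

lemma trace_eq_sum_weight:
  fixes w :: "nat \<Rightarrow> nat \<Rightarrow> real"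
  assumes T: "T \<in> carrier_mat (D ^ n) (D ^ n)" and \<rho>: "\<rho> \<in> carrier_mat (D ^ n) (D ^ n)"
    and TI: "\<And>r c. r < D ^ n \<Longrightarrow> c < D ^ n \<Longrightarrow> T $$ (r, c) =
      (\<Prod>i<n. \<Sum>k<D. of_real (w i k) * (v k (digit D i r) * cnj (v k (digit D i c))))"
  shows "Re (mtrace (T * \<rho>)) = (\<Sum>x\<in>words D n. (\<Prod>i<n. w i (x i)) * weight n \<rho> x)"
proof -
  have TI': "T $$ (r, c) = (\<Sum>x\<in>words D n. of_real (\<Prod>i<n. w i (x i)) *
      (vec_at n x r * cnj (vec_at n x c)))" if "r < D ^ n" "c < D ^ n" for r c
    unfolding TI[OF that] vec_at_def
    by (subst prod_sum_PiE) (auto simp: prod.distrib intro!: sum.cong)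
  have "mtrace (T * \<rho>) = (\<Sum>r<D ^ n. \<Sum>c<D ^ n. \<Sum>x\<in>words D n. of_real (\<Prod>i<n. w i (x i)) *
      (vec_at n x r * cnj (vec_at n x c) * \<rho> $$ (c, r)))"
    unfolding mtrace_mult[OF T \<rho>]
    by (intro sum.cong refl) (simp add: TI' sum_distrib_right mult.assoc)
  also have "\<dots> = (\<Sum>r<D ^ n. \<Sum>x\<in>words D n. \<Sum>c<D ^ n. of_real (\<Prod>i<n. w i (x i)) *
      (vec_at n x r * cnj (vec_at n x c) * \<rho> $$ (c, r)))"
    by (intro sum.cong refl sum.swap)
  also have "\<dots> = (\<Sum>x\<in>words D n. \<Sum>r<D ^ n. \<Sum>c<D ^ n. of_real (\<Prod>i<n. w i (x i)) *
      (vec_at n x r * cnj (vec_at n x c) * \<rho> $$ (c, r)))"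
    by (rule sum.swap)
  also have "\<dots> = (\<Sum>x\<in>words D n. of_real (\<Prod>i<n. w i (x i)) *
      (\<Sum>r<D ^ n. \<Sum>c<D ^ n. vec_at n x r * cnj (vec_at n x c) * \<rho> $$ (c, r)))"
    by (simp only: sum_distrib_left)
  finally have "mtrace (T * \<rho>) = \<dots>" .
  thus ?thesis
    by (simp only: Re_sum weight_def Re_complex_of_real times_complex.sel Im_complex_of_real) simp
qed

lemma tensor_pow_ext_carrier: "tensor_pow_ext D N A B \<in> carrier_mat (D ^ (N + 1)) (D ^ (N + 1))"
  by (simp add: tensor_pow_ext_def)

lemma p_rho_eq_sum_weight:
  assumes "\<rho> \<in> carrier_mat (D ^ (N + 1)) (D ^ (N + 1))"
  shows "p_rho D N \<Omega> \<rho> = (\<Sum>x\<in>words D (N + 1). (\<Prod>i<N. l (x i)) * weight (N + 1) \<rho> x)"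
proof -
  have "p_rho D N \<Omega> \<rho> = (\<Sum>x\<in>words D (N + 1).
      (\<Prod>i<N + 1. if i < N then l (x i) else 1) * weight (N + 1) \<rho> x)"
    unfolding p_rho_def
  proof (rule trace_eq_sum_weight[OF tensor_pow_ext_carrier assms])
    fix r c assume "r < D ^ (N + 1)" "c < D ^ (N + 1)"
    thus "tensor_pow_ext D N \<Omega> (1\<^sub>m D) $$ (r, c) = (\<Prod>i<N + 1. \<Sum>k<D.
        of_real (if i < N then l k else 1) * (v k (digit D i r) * cnj (v k (digit D i c))))"
      using digit_less[OF D_pos]
      by (simp add: tensor_pow_ext_def Omega_index complete)
  qed
  thus ?thesis by simp
qed

lemma f_rho_eq_sum_weight:
  assumes "\<rho> \<in> carrier_mat (D ^ (N + 1)) (D ^ (N + 1))"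
  shows "f_rho D \<psi> N \<Omega> \<rho> = (\<Sum>x\<in>words D (N + 1).
    (\<Prod>i<N. l (x i)) * of_bool (x N = z) * weight (N + 1) \<rho> x)"
proof -
  have "f_rho D \<psi> N \<Omega> \<rho> = (\<Sum>x\<in>words D (N + 1).
      (\<Prod>i<N + 1. if i < N then l (x i) else of_bool (x i = z)) * weight (N + 1) \<rho> x)"
    unfolding f_rho_def
  proof (rule trace_eq_sum_weight[OF tensor_pow_ext_carrier assms])
    fix r c assume "r < D ^ (N + 1)" "c < D ^ (N + 1)"
    moreover have "(\<Sum>k<D. of_real (of_bool (k = z)) * (v k a * cnj (v k b))) = v z a * cnj (v z b)"
      for a b
    proof -
      have "(\<Sum>k<D. of_real (of_bool (k = z)) * (v k a * cnj (v k b)))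
          = (\<Sum>k<D. if k = z then v z a * cnj (v z b) else 0)"
        by (intro sum.cong) auto
      thus ?thesis using z by simp
    qed
    ultimately show "tensor_pow_ext D N \<Omega> (proj_mat D \<psi>) $$ (r, c) = (\<Prod>i<N + 1. \<Sum>k<D.
        of_real (if i < N then l k else of_bool (k = z)) *
          (v k (digit D i r) * cnj (v k (digit D i c))))"
      using digit_less[OF D_pos]
      by (simp add: tensor_pow_ext_def Omega_index proj_mat_def psi_index)
  qed
  thus ?thesis by simp
qed

lemma sum_weight:
  assumes \<rho>: "\<rho> \<in> carrier_mat (D ^ n) (D ^ n)"
  shows "(\<Sum>x\<in>words D n. weight n \<rho> x) = Re (mtrace \<rho>)"
proof -
  have "Re (mtrace (1\<^sub>m (D ^ n) * \<rho>)) = (\<Sum>x\<in>words D n. (\<Prod>i<n. 1) * weight n \<rho> x)"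
  proof (rule trace_eq_sum_weight[OF one_carrier_mat \<rho>])
    fix r c assume rc: "r < D ^ n" "c < D ^ n"
    have "(\<Prod>i<n. \<Sum>k<D. of_real 1 * (v k (digit D i r) * cnj (v k (digit D i c))))
        = (\<Prod>i<n. of_bool (digit D i r = digit D i c) :: complex)"
      using digit_less[OF D_pos] by (intro prod.cong) (auto simp: complete)
    also have "\<dots> = of_bool (r = c)"
      using digits_eq_iff[OF rc] by (auto simp: of_bool_def prod_zero_iff)
    finally show "1\<^sub>m (D ^ n) $$ (r, c) =
        (\<Prod>i<n. \<Sum>k<D. of_real 1 * (v k (digit D i r) * cnj (v k (digit D i c))))"
      using rc by simp
  qed
  thus ?thesis using \<rho> by simp
qed

lemma vec_at_perm_idx:
  assumes "\<pi> permutes {..<n}"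
  shows "vec_at n (x \<circ> \<pi>) (perm_idx D n \<pi> r) = vec_at n x r"
proof -
  have "vec_at n (x \<circ> \<pi>) (perm_idx D n \<pi> r) = (\<Prod>i<n. v (x (\<pi> i)) (digit D (\<pi> i) r))"
    unfolding vec_at_def using digit_perm_idx[OF D_pos] by (intro prod.cong) auto
  also have "\<dots> = vec_at n x r"
    unfolding vec_at_def
    by (rule prod.reindex_bij_betw[OF permutes_imp_bij[OF assms], where g = "\<lambda>i. v (x i) (digit D i r)"])
  finally show ?thesis .
qed

lemma weight_perm:
  assumes "perm_invariant D n \<rho>" "\<rho> \<in> carrier_mat (D ^ n) (D ^ n)" "\<pi> permutes {..<n}"
  shows "weight n \<rho> (x \<circ> \<pi>) = weight n \<rho> x"
proof -
  let ?s = "perm_idx D n \<pi>" and ?u = "vec_at n (x \<circ> \<pi>)"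
  note bij = bij_betw_perm_idx[OF D_pos assms(3)]
  have inv: "\<rho> $$ (?s c, ?s r) = \<rho> $$ (c, r)" if "c < D ^ n" "r < D ^ n" for c r
    using perm_op_commute_iff[OF D_pos assms(3,2)] assms(1,3) that by (auto simp: perm_invariant_def)
  have "(\<Sum>r<D ^ n. \<Sum>c<D ^ n. ?u r * cnj (?u c) * \<rho> $$ (c, r))
      = (\<Sum>r<D ^ n. \<Sum>c<D ^ n. ?u (?s r) * cnj (?u c) * \<rho> $$ (c, ?s r))"
    by (rule sum.reindex_bij_betw[OF bij, symmetric])
  also have "\<dots> = (\<Sum>r<D ^ n. \<Sum>c<D ^ n. ?u (?s r) * cnj (?u (?s c)) * \<rho> $$ (?s c, ?s r))"
    by (intro sum.cong refl sum.reindex_bij_betw[OF bij, symmetric])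
  also have "\<dots> = (\<Sum>r<D ^ n. \<Sum>c<D ^ n. vec_at n x r * cnj (vec_at n x c) * \<rho> $$ (c, r))"
    by (intro sum.cong) (auto simp: inv vec_at_perm_idx[OF assms(3)])
  finally show ?thesis by (simp add: weight_def)
qed

text \<open>Substituting the transposition of the two positions preserves the weights. Hence
  \<open>p - f\<close> does not depend on which system is left unmeasured, which is what makes
  averaging possible.\<close>

lemma sum_weight_position:
  fixes g :: "nat \<Rightarrow> real"
  assumes "perm_invariant D n \<rho>" "\<rho> \<in> carrier_mat (D ^ n) (D ^ n)" "a < n" "b < n"
  shows "(\<Sum>x\<in>words D n. (\<Prod>i\<in>{..<n} - {a}. l (x i)) * g (x a) * weight n \<rho> x)
    = (\<Sum>x\<in>words D n. (\<Prod>i\<in>{..<n} - {b}. l (x i)) * g (x b) * weight n \<rho> x)"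
proof -
  define t where "t = transpose a b"
  have t: "t permutes {..<n}" unfolding t_def using assms by (intro permutes_swap_id) auto
  have tt: "t (t i) = i" for i by (simp add: t_def)
  have "bij_betw (\<lambda>x. x \<circ> t) (words D n) (words D n)"
  proof (rule bij_betw_byWitness[where f' = "\<lambda>x. x \<circ> t"])
    have "x \<circ> t \<in> words D n" if "x \<in> words D n" for x
      using that permutes_in_image[OF t] permutes_not_in[OF t] by (auto simp: PiE_iff extensional_def)
    thus "(\<lambda>x. x \<circ> t) ` words D n \<subseteq> words D n" "(\<lambda>x. x \<circ> t) ` words D n \<subseteq> words D n" by auto
  qed (auto simp: tt fun_eq_iff)
  hence "(\<Sum>x\<in>words D n. (\<Prod>i\<in>{..<n} - {a}. l (x i)) * g (x a) * weight n \<rho> x)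
      = (\<Sum>x\<in>words D n. (\<Prod>i\<in>{..<n} - {a}. l ((x \<circ> t) i)) * g ((x \<circ> t) a) * weight n \<rho> (x \<circ> t))"
    by (rule sum.reindex_bij_betw[symmetric])
  also have "\<dots> = (\<Sum>x\<in>words D n. (\<Prod>i\<in>{..<n} - {b}. l (x i)) * g (x b) * weight n \<rho> x)"
  proof (intro sum.cong refl)
    fix x
    have "bij_betw t ({..<n} - {a}) ({..<n} - {b})"
    proof (rule bij_betw_imageI)
      show "inj_on t ({..<n} - {a})" using permutes_inj_on[OF t] .
      show "t ` ({..<n} - {a}) = {..<n} - {b}"
        unfolding image_set_diff[OF permutes_inj[OF t]] permutes_image[OF t] by (simp add: t_def)
    qed
    hence "(\<Prod>i\<in>{..<n} - {a}. l (x (t i))) = (\<Prod>i\<in>{..<n} - {b}. l (x i))"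
      by (rule prod.reindex_bij_betw)
    thus "(\<Prod>i\<in>{..<n} - {a}. l ((x \<circ> t) i)) * g ((x \<circ> t) a) * weight n \<rho> (x \<circ> t)
        = (\<Prod>i\<in>{..<n} - {b}. l (x i)) * g (x b) * weight n \<rho> x"
      using weight_perm[OF assms(1,2) t] by (simp add: t_def)
  qed
  finally show ?thesis .
qed

section \<open>From the infidelity of a word to the number of tests\<close>

text \<open>Removing one letter from the product \<open>?y\<close> means dividing by its eigenvalue,
  and \<open>H\<close> turns the missing factor into a logarithm: the term is at most
  \<open>H * ?y * ln (1 / l (x m))\<close>. This holds trivially for the letter \<open>z\<close>,
  where both sides vanish, and the logarithms add up to \<open>ln (1 / ?y)\<close>.\<close>

lemma sum_failure_le_entr:
  assumes l: "\<And>k. k < D \<Longrightarrow> 0 < l k"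
    and H: "\<And>k. k < D \<Longrightarrow> k \<noteq> z \<Longrightarrow> 1 \<le> H * entr (l k)"
    and x: "x \<in> words D n"
  shows "(\<Sum>m<n. (\<Prod>i\<in>{..<n} - {m}. l (x i)) * of_bool (x m \<noteq> z)) \<le> H * entr (\<Prod>i<n. l (x i))"
proof -
  let ?y = "\<Prod>i<n. l (x i)"
  have xD: "x i < D" if "i < n" for i using x that by auto
  have y0: "0 < ?y" using l xD by (intro prod_pos) auto
  have "(\<Prod>i\<in>{..<n} - {m}. l (x i)) * of_bool (x m \<noteq> z) \<le> H * ?y * ln (1 / l (x m))"
    if m: "m < n" for m
  proof (cases "x m = z")
    case True
    thus ?thesis using z by simp
  next
    case False
    let ?q = "\<Prod>i\<in>{..<n} - {m}. l (x i)"
    have y: "?y = l (x m) * ?q" using m by (intro prod.remove) auto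
    have "0 < ?q" using l xD by (intro prod_pos) auto
    hence "?q * 1 \<le> ?q * (H * entr (l (x m)))"
      using H[OF xD[OF m] False] by (intro mult_left_mono) auto
    thus ?thesis using False unfolding y by (simp add: entr_def mult_ac)
  qed
  hence "(\<Sum>m<n. (\<Prod>i\<in>{..<n} - {m}. l (x i)) * of_bool (x m \<noteq> z))
      \<le> (\<Sum>m<n. H * ?y * ln (1 / l (x m)))"
    by (intro sum_mono) auto
  also have "\<dots> = H * ?y * (\<Sum>m<n. - ln (l (x m)))"
    unfolding sum_distrib_left using l xD by (intro sum.cong) (auto simp: ln_div)
  also have "(\<Sum>m<n. - ln (l (x m))) = ln (1 / ?y)"
  proof -
    have "ln ?y = (\<Sum>m<n. ln (l (x m)))"
    proof (rule ln_prod)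
      fix i assume "i \<in> {..<n}"
      thus "l (x i) \<noteq> 0" using l[of "x i"] xD[of i] by simp
    qed simp
    moreover have "ln (1 / ?y) = - ln ?y" by (simp only: divide_inverse mult_1 ln_inverse)
    ultimately show ?thesis by (simp only: sum_negf)
  qed
  finally show ?thesis by (simp add: entr_def mult_ac)
qed

lemma f_rho_ge:
  fixes N :: nat
  assumes l: "\<And>k. k < D \<Longrightarrow> 0 < l k" "\<And>k. k < D \<Longrightarrow> l k \<le> 1"
    and H: "0 < H" "\<And>k. k < D \<Longrightarrow> k \<noteq> z \<Longrightarrow> 1 \<le> H * entr (l k)"
    and ed: "0 < \<epsilon>" "\<epsilon> < 1" "0 < \<delta>" "\<delta> < 1"
    and N: "H * ln (1 / ((1 - \<epsilon>) * \<delta>)) / \<epsilon> \<le> real N + 1"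
    and \<rho>: "density_op (D ^ (N + 1)) \<rho>" "perm_invariant D (N + 1) \<rho>" "\<delta> \<le> p_rho D N \<Omega> \<rho>"
  shows "(1 - \<epsilon>) * p_rho D N \<Omega> \<rho> \<le> f_rho D \<psi> N \<Omega> \<rho>"
proof -
  let ?n = "N + 1" and ?q = "weight (N + 1) \<rho>"
  have psd: "psd_mat (D ^ ?n) \<rho>" and tr: "mtrace \<rho> = 1" using \<rho> by (auto simp: density_op_def)
  have c: "\<rho> \<in> carrier_mat (D ^ ?n) (D ^ ?n)" using psd by (simp add: psd_mat_def hermitian_mat_def)
  define P where "P = p_rho D N \<Omega> \<rho>"
  define f where "f = f_rho D \<psi> N \<Omega> \<rho>"
  \<comment> \<open>the probability that all \<open>N + 1\<close> tests are passed\<close>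
  define Y where "Y = (\<Sum>x\<in>words D ?n. (\<Prod>i<?n. l (x i)) * ?q x)"
  define y0 where "y0 = (1 - \<epsilon>) * \<delta>"
  define L where "L = ln (1 / y0)"
  note peq = p_rho_eq_sum_weight[OF c, folded P_def]
  note feq = f_rho_eq_sum_weight[OF c, folded f_def]
  have xD: "x i < D" if "x \<in> words D ?n" "i < ?n" for x i
    using PiE_mem[OF that(1), of i] that(2) by simp
  have q0: "0 \<le> ?q x" for x by (rule weight_nonneg[OF psd])
  have pr0: "0 \<le> (\<Prod>i<N. l (x i))" if "x \<in> words D ?n" for x
  proof (rule prod_nonneg)
    fix i assume "i \<in> {..<N}"
    hence "x i < D" using xD[OF that, of i] by simp
    thus "0 \<le> l (x i)" by (rule less_imp_le[OF l(1)])
  qed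
  have fY: "f \<le> Y"
    unfolding feq Y_def
  proof (intro sum_mono mult_right_mono q0)
    fix x assume x: "x \<in> words D ?n"
    have "0 < l (x N)" using l(1) xD[OF x, of N] by simp
    thus "(\<Prod>i<N. l (x i)) * of_bool (x N = z) \<le> (\<Prod>i<?n. l (x i))"
      using pr0[OF x] z(2) by (cases "x N = z") simp_all
  qed
  have YP: "Y \<le> P"
    unfolding peq Y_def
  proof (intro sum_mono mult_right_mono q0)
    fix x assume x: "x \<in> words D ?n"
    show "(\<Prod>i<?n. l (x i)) \<le> (\<Prod>i<N. l (x i))"
      using mult_left_mono[OF l(2)[OF xD[OF x, of N]] pr0[OF x]] by simp
  qed
  have y0: "0 < y0" "y0 < 1 - \<epsilon>" using ed by (auto simp: y0_def)
  have eL: "\<epsilon> < L"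
  proof -
    have "ln y0 < ln (1 - \<epsilon>)" using y0 ed by (subst ln_less_cancel_iff) auto
    also have "\<dots> \<le> - \<epsilon>" using ln_le_minus_one[of "1 - \<epsilon>"] ed by simp
    finally show ?thesis using y0 by (simp add: L_def ln_div)
  qed
  have sets: "{..<?n} - {N} = {..<N}" by auto
  have "P - f = (\<Sum>x\<in>words D ?n. (\<Prod>i\<in>{..<?n} - {N}. l (x i)) * of_bool (x N \<noteq> z) * ?q x)"
    unfolding peq feq sets sum_subtractf[symmetric]
    by (intro sum.cong) (auto simp: algebra_simps)
  \<comment> \<open>The same difference is written once for each position, and the copies are then
    added.\<close>
  hence "P - f = (\<Sum>x\<in>words D ?n. (\<Prod>i\<in>{..<?n} - {m}. l (x i)) * of_bool (x m \<noteq> z) * ?q x)"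
    if "m < ?n" for m
    using sum_weight_position[OF \<rho>(2) c, of N m "\<lambda>k. of_bool (k \<noteq> z)"] that by simp
  hence "(\<Sum>m<?n. P - f)
      = (\<Sum>m<?n. \<Sum>x\<in>words D ?n. (\<Prod>i\<in>{..<?n} - {m}. l (x i)) * of_bool (x m \<noteq> z) * ?q x)"
    by (intro sum.cong) auto
  also have "\<dots> = (\<Sum>x\<in>words D ?n.
      (\<Sum>m<?n. (\<Prod>i\<in>{..<?n} - {m}. l (x i)) * of_bool (x m \<noteq> z)) * ?q x)"
    unfolding sum_distrib_right by (rule sum.swap)
  also have "\<dots> \<le> (\<Sum>x\<in>words D ?n. (H * ((\<Prod>i<?n. l (x i)) * (L - 1) + y0)) * ?q x)"
  proof (intro sum_mono mult_right_mono q0)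
    fix x assume x: "x \<in> words D ?n"
    have "0 < (\<Prod>i<?n. l (x i))" using l xD[OF x] by (intro prod_pos) auto
    hence "H * entr (\<Prod>i<?n. l (x i)) \<le> H * ((\<Prod>i<?n. l (x i)) * (L - 1) + y0)"
      using entr_le_tangent[OF _ y0(1)] H(1) unfolding L_def by (intro mult_left_mono) auto
    thus "(\<Sum>m<?n. (\<Prod>i\<in>{..<?n} - {m}. l (x i)) * of_bool (x m \<noteq> z))
        \<le> H * ((\<Prod>i<?n. l (x i)) * (L - 1) + y0)"
      using sum_failure_le_entr[OF l(1) H(2) x] by linarith
  qed
  also have "\<dots> = H * ((L - 1) * Y + y0 * (\<Sum>x\<in>words D ?n. ?q x))"
    unfolding Y_def sum_distrib_left sum.distrib[symmetric]
    by (intro sum.cong) (auto simp: algebra_simps)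
  also have "\<dots> = H * ((L - 1) * Y + y0)" using sum_weight[OF c] tr by simp
  finally have main: "(real N + 1) * (P - f) \<le> H * ((L - 1) * Y + y0)" by (simp add: add.commute)
  define a where "a = H / (real N + 1)"
  have a0: "0 < a" using H(1) by (simp add: a_def)
  have aL: "a * L \<le> \<epsilon>" using N ed unfolding a_def L_def y0_def by (simp add: field_simps)
  \<comment> \<open>This makes the coefficient \<open>1 + a * L - a\<close> nonnegative, so that
    \<open>Y\<close> can be replaced by its upper bound \<open>y0\<close> in the second case
    below.\<close>
  have a1: "a \<le> 1"
  proof -
    have "a * L \<le> 1 * L" using aL eL by simp
    thus ?thesis using eL ed by (simp add: mult_le_cancel_right)
  qed
  have gap: "P - f \<le> a * ((L - 1) * Y + y0)"
    using main unfolding a_def by (simp add: field_simps)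
  have P: "\<delta> \<le> P" using \<rho>(3) by (simp add: P_def)
  have "P - f \<le> \<epsilon> * P"
  proof (cases "y0 \<le> Y")
    case True
    have "a * ((L - 1) * Y + y0) \<le> a * (L * Y)"
      using True a0 by (intro mult_left_mono) (auto simp: algebra_simps)
    also have "\<dots> = a * L * Y" by simp
    also have "\<dots> \<le> \<epsilon> * P"
      using aL YP True y0 ed by (intro mult_mono) auto
    finally show ?thesis using gap by linarith
  next
    case False
    \<comment> \<open>With \<open>f \<le> Y\<close> the gap bounds \<open>P\<close> by
      \<open>Y\<close> alone. For \<open>Y < y0\<close> this gives at most
      \<open>y0 * (1 + \<epsilon>) = \<delta> * (1 - \<epsilon>\<^sup>2)\<close>, contradicting
      \<open>\<delta> \<le> P\<close>.\<close>
    have "P \<le> Y * (1 + a * L - a) + a * y0" using gap fY by (simp add: algebra_simps)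
    also have "\<dots> \<le> y0 * (1 + a * L - a) + a * y0"
    proof -
      have "0 \<le> a * L" using a0 eL ed by simp
      hence "Y * (1 + a * L - a) \<le> y0 * (1 + a * L - a)"
        using False a1 by (intro mult_right_mono) auto
      thus ?thesis by simp
    qed
    also have "\<dots> = y0 * (1 + a * L)" by (simp add: algebra_simps)
    also have "\<dots> \<le> y0 * (1 + \<epsilon>)" using aL y0 by (intro mult_left_mono) auto
    also have "\<dots> = \<delta> * (1 - \<epsilon>\<^sup>2)" by (simp add: y0_def power2_eq_square algebra_simps)
    also have "\<dots> < \<delta>" using ed by simp
    finally show ?thesis using P by simp
  qed
  thus ?thesis unfolding P_def f_def by (simp add: algebra_simps)
qed

text \<open>Guards against an infimum over the empty set. The witness consists of independent copies
  of the target state, which pass every test and so are feasible for every \<delta> below 1.\<close>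

lemma exists_passing_state:
  "\<exists>\<rho>. density_op (D ^ (N + 1)) \<rho> \<and> perm_invariant D (N + 1) \<rho> \<and> p_rho D N \<Omega> \<rho> = 1"
proof -
  let ?n = "N + 1" and ?d = "D ^ (N + 1)"
  define u where "u = vec_at ?n (\<lambda>_. z)"
  define \<rho> where "\<rho> = mat ?d ?d (\<lambda>(r, c). u r * cnj (u c))"
  have c: "\<rho> \<in> carrier_mat ?d ?d" by (simp add: \<rho>_def)
  have herm: "hermitian_mat ?d \<rho>" by (auto simp: hermitian_mat_def \<rho>_def)
  have "0 \<le> Re (conjugate w \<bullet> (\<rho> *\<^sub>v w))" if w: "w \<in> carrier_vec ?d" for w
  proof -
    let ?s = "\<Sum>i<?d. cnj (w $ i) * u i"
    have "conjugate w \<bullet> (\<rho> *\<^sub>v w) = (\<Sum>i<?d. cnj (w $ i) * (\<rho> *\<^sub>v w) $ i)"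
      using w c by (auto simp: scalar_prod_def lessThan_atLeast0 intro!: sum.cong)
    also have "\<dots> = (\<Sum>i<?d. \<Sum>j<?d. (cnj (w $ i) * u i) * cnj (cnj (w $ j) * u j))"
      using mult_vec_index[OF c w]
      by (intro sum.cong) (auto simp: \<rho>_def sum_distrib_left mult_ac simp del: index_mult_mat_vec)
    also have "\<dots> = ?s * cnj ?s" by (simp add: sum_product)
    also have "\<dots> = of_real ((cmod ?s)\<^sup>2)" by (rule complex_norm_square[symmetric])
    finally have "conjugate w \<bullet> (\<rho> *\<^sub>v w) = of_real ((cmod ?s)\<^sup>2)" .
    thus ?thesis by simp
  qed
  hence psd: "psd_mat ?d \<rho>" using herm by (simp add: psd_mat_def)
  \<comment> \<open>Orthonormality of the product basis; it yields both the trace and the fact that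
    the whole weight sits on the constant word.\<close>
  have overlap: "(\<Sum>r<?d. vec_at ?n x r * cnj (u r)) = of_bool (\<forall>i<?n. x i = z)"
    if x: "\<And>i. i < ?n \<Longrightarrow> x i < D" for x
  proof -
    have "(\<Sum>r<?d. vec_at ?n x r * cnj (u r))
        = (\<Sum>r<?d. \<Prod>i<?n. v (x i) (digit D i r) * cnj (v z (digit D i r)))"
      by (simp only: u_def vec_at_def prod.distrib cnj_prod)
    also have "\<dots> = (\<Prod>i<?n. \<Sum>a<D. v (x i) a * cnj (v z a))"
      by (rule sum_prod_digits[OF D_pos])
    also have "\<dots> = (\<Prod>i<?n. of_bool (x i = z))"
    proof (intro prod.cong refl)
      fix i assume "i \<in> {..<?n}"
      hence "x i < D" using x by simp
      from orthonormal[OF z(1) this] show "(\<Sum>a<D. v (x i) a * cnj (v z a)) = of_bool (x i = z)"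
        by (simp add: mult.commute)
    qed
    also have "\<dots> = of_bool (\<forall>i<?n. x i = z)"
    proof (cases "\<forall>i<?n. x i = z")
      case False
      then obtain i where "i < ?n" "x i \<noteq> z" by blast
      hence "(\<Prod>i<?n. of_bool (x i = z) :: complex) = 0" by (intro prod_zero) auto
      thus ?thesis using False by simp
    qed simp
    finally show ?thesis .
  qed
  have "mtrace \<rho> = (\<Sum>r<?d. vec_at ?n (\<lambda>_. z) r * cnj (u r))"
    by (simp add: mtrace_def \<rho>_def u_def)
  also have "\<dots> = 1" using overlap[of "\<lambda>_. z"] z by simp
  finally have dens: "density_op ?d \<rho>" using psd by (simp add: density_op_def)
  have perm: "perm_invariant D ?n \<rho>"
    unfolding perm_invariant_def
  proof (intro allI impI)
    fix \<pi> assume \<pi>: "\<pi> permutes {..<?n}"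
    have "u (perm_idx D ?n \<pi> r) = u r" for r
      using vec_at_perm_idx[OF \<pi>, of "\<lambda>_. z" r] by (simp add: u_def comp_def)
    thus "perm_op D ?n \<pi> * \<rho> = \<rho> * perm_op D ?n \<pi>"
      using perm_idx_less[OF D_pos, of ?n \<pi>]
      by (subst perm_op_commute_iff[OF D_pos \<pi> c]) (auto simp: \<rho>_def)
  qed
  let ?x0 = "restrict (\<lambda>_. z) {..<?n}"
  have w: "weight ?n \<rho> x = of_bool (x = ?x0)" if x: "x \<in> words D ?n" for x
  proof -
    have "(\<Sum>r<?d. \<Sum>c<?d. vec_at ?n x r * cnj (vec_at ?n x c) * \<rho> $$ (c, r))
        = (\<Sum>r<?d. vec_at ?n x r * cnj (u r)) * cnj (\<Sum>r<?d. vec_at ?n x r * cnj (u r))"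
      unfolding cnj_sum sum_product by (intro sum.cong) (auto simp: \<rho>_def)
    also have "\<dots> = of_bool (\<forall>i<?n. x i = z)"
    proof -
      have "(\<Sum>r<?d. vec_at ?n x r * cnj (u r)) = of_bool (\<forall>i<?n. x i = z)"
        using x by (intro overlap) auto
      moreover have "of_bool Q * cnj (of_bool Q) = (of_bool Q :: complex)" for Q by (cases Q) auto
      ultimately show ?thesis by (simp only:)
    qed
    finally have "weight ?n \<rho> x = of_bool (\<forall>i<?n. x i = z)" by (simp add: weight_def)
    moreover have "(\<forall>i<?n. x i = z) \<longleftrightarrow> x = ?x0"
    proof
      assume eq: "\<forall>i<?n. x i = z"
      show "x = ?x0"
      proof
        fix i show "x i = ?x0 i" using eq PiE_arb[OF x, of i] by simp
      qed
    qed simp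
    ultimately show ?thesis by simp
  qed
  have x0: "?x0 \<in> words D ?n" using z(1) by (simp only: restrict_PiE_iff) simp
  have "(\<Prod>i<N. l (x i)) * weight ?n \<rho> x = (if x = ?x0 then 1 else 0)" if "x \<in> words D ?n" for x
  proof (cases "x = ?x0")
    case True
    have "(\<Prod>i<N. l (x i)) = 1" unfolding True by (rule prod.neutral) (simp add: z(2))
    thus ?thesis using w[OF that] True by (simp only: of_bool_eq mult_1 if_True refl)
  qed (simp only: w[OF that] of_bool_eq mult_zero_right if_False)
  hence "p_rho D N \<Omega> \<rho> = (\<Sum>x\<in>words D ?n. if x = ?x0 then 1 else 0)"
    unfolding p_rho_eq_sum_weight[OF c] by (intro sum.cong refl)
  also have "\<dots> = 1" using x0 by (simp only: sum.delta[OF finite_words] if_True)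
  finally show ?thesis using dens perm by blast
qed

lemma Fmin_ge:
  assumes l: "\<And>k. k < D \<Longrightarrow> 0 < l k" "\<And>k. k < D \<Longrightarrow> l k \<le> 1"
    and H: "0 < H" "\<And>k. k < D \<Longrightarrow> k \<noteq> z \<Longrightarrow> 1 \<le> H * entr (l k)"
    and ed: "0 < \<epsilon>" "\<epsilon> < 1" "0 < \<delta>" "\<delta> < 1"
    and N: "H * ln (1 / ((1 - \<epsilon>) * \<delta>)) / \<epsilon> \<le> real N + 1"
  shows "1 - \<epsilon> \<le> Fmin D \<psi> N \<delta> \<Omega>"
  unfolding Fmin_def
proof (rule cInf_greatest)
  obtain \<rho> where "density_op (D ^ (N + 1)) \<rho>" "perm_invariant D (N + 1) \<rho>" "p_rho D N \<Omega> \<rho> = 1"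
    using exists_passing_state by blast
  thus "{f_rho D \<psi> N \<Omega> \<rho> / p_rho D N \<Omega> \<rho> | \<rho>. density_op (D ^ (N + 1)) \<rho> \<and>
      perm_invariant D (N + 1) \<rho> \<and> \<delta> \<le> p_rho D N \<Omega> \<rho>} \<noteq> {}"
    using ed by (auto intro!: exI[of _ \<rho>])
next
  fix y assume "y \<in> {f_rho D \<psi> N \<Omega> \<rho> / p_rho D N \<Omega> \<rho> | \<rho>. density_op (D ^ (N + 1)) \<rho> \<and>
      perm_invariant D (N + 1) \<rho> \<and> \<delta> \<le> p_rho D N \<Omega> \<rho>}"
  then obtain \<rho> where \<rho>: "density_op (D ^ (N + 1)) \<rho>" "perm_invariant D (N + 1) \<rho>"
    "\<delta> \<le> p_rho D N \<Omega> \<rho>" and y: "y = f_rho D \<psi> N \<Omega> \<rho> / p_rho D N \<Omega> \<rho>" by blast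
  have "(1 - \<epsilon>) * p_rho D N \<Omega> \<rho> \<le> f_rho D \<psi> N \<Omega> \<rho>"
    by (rule f_rho_ge[OF l H ed N \<rho>])
  moreover have "0 < p_rho D N \<Omega> \<rho>" using \<rho>(3) ed by linarith
  ultimately show "1 - \<epsilon> \<le> y" unfolding y by (simp add: le_divide_eq)
qed

text \<open>\<open>H \<ge> 1\<close> together with \<open>?L > \<epsilon>\<close> gives
  \<open>X > 1\<close>, which is what lets the chosen number of tests be at least 1.\<close>

lemma Nmin_less:
  assumes l: "\<And>k. k < D \<Longrightarrow> 0 < l k" "\<And>k. k < D \<Longrightarrow> l k \<le> 1"
    and H: "1 \<le> H" "\<And>k. k < D \<Longrightarrow> k \<noteq> z \<Longrightarrow> 1 \<le> H * entr (l k)"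
    and ed: "0 < \<epsilon>" "\<epsilon> < 1" "0 < \<delta>" "\<delta> < 1"
  shows "\<exists>N\<ge>1. 1 - \<epsilon> \<le> Fmin D \<psi> N \<delta> \<Omega>"
    and "real (Nmin D \<psi> \<epsilon> \<delta> \<Omega>) < H * ln (1 / ((1 - \<epsilon>) * \<delta>)) / \<epsilon>"
proof -
  let ?L = "ln (1 / ((1 - \<epsilon>) * \<delta>))"
  define X where "X = H * ?L / \<epsilon>"
  have "\<epsilon> < ?L"
  proof -
    have "ln ((1 - \<epsilon>) * \<delta>) < ln (1 - \<epsilon>)" using ed by (subst ln_less_cancel_iff) auto
    also have "\<dots> \<le> - \<epsilon>" using ln_le_minus_one[of "1 - \<epsilon>"] ed by simp
    finally show ?thesis using ed by (subst ln_div) auto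
  qed
  moreover from this have "1 * ?L \<le> H * ?L" using H(1) ed by (intro mult_right_mono) linarith+
  ultimately have X1: "1 < X" unfolding X_def using ed by (simp add: less_divide_eq)
  \<comment> \<open>Rounding up and subtracting one meets \<open>X \<le> real N + 1\<close> and
    still stays strictly below \<open>X\<close>.\<close>
  define N where "N = nat (\<lceil>X\<rceil> - 1)"
  have N: "real N < X" "X \<le> real N + 1" "1 \<le> N"
    using X1 unfolding N_def by linarith+
  have "1 - \<epsilon> \<le> Fmin D \<psi> N \<delta> \<Omega>"
    using N(2) H(1) by (intro Fmin_ge[OF l _ H(2) ed]) (auto simp: X_def)
  hence ok: "1 \<le> N \<and> 1 - \<epsilon> \<le> Fmin D \<psi> N \<delta> \<Omega>" using N by simp
  thus "\<exists>N\<ge>1. 1 - \<epsilon> \<le> Fmin D \<psi> N \<delta> \<Omega>" by blast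
  have "Nmin D \<psi> \<epsilon> \<delta> \<Omega> \<le> N" unfolding Nmin_def using ok by (rule Least_le)
  thus "real (Nmin D \<psi> \<epsilon> \<delta> \<Omega>) < H * ?L / \<epsilon>" using N(1) by (simp add: X_def)
qed

text \<open>The identity is diagonal in every orthonormal basis, so eigenvectors and target index
  persist and all the estimates can be applied to the mixed operator.\<close>

lemma verification_Omega_p: "verification D \<psi> (Omega_p D p \<Omega>) v (\<lambda>k. (1 - p) * l k + p) z"
proof
  fix a b assume ab: "a < D" "b < D"
  have "Omega_p D p \<Omega> $$ (a, b) = of_real (1 - p) * \<Omega> $$ (a, b) + of_real p * (if a = b then 1 else 0)"
    using ab Omega_carrier by (simp add: Omega_p_def)
  also have "\<dots> = of_real (1 - p) * (\<Sum>k<D. of_real (l k) * (v k a * cnj (v k b)))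
      + of_real p * (\<Sum>k<D. v k a * cnj (v k b))"
    unfolding complete[OF ab, symmetric] Omega_index[OF ab] ..
  also have "\<dots> = (\<Sum>k<D. of_real ((1 - p) * l k + p) * (v k a * cnj (v k b)))"
    unfolding sum_distrib_left sum.distrib[symmetric]
    by (intro sum.cong) (auto simp: algebra_simps)
  finally show "Omega_p D p \<Omega> $$ (a, b) =
      (\<Sum>k<D. of_real ((1 - p) * l k + p) * (v k a * cnj (v k b)))" .
qed (use orthonormal complete Omega_carrier z psi_index in \<open>auto simp: Omega_p_def\<close>)

end

text \<open>Apart from 1, the eigenvalues of the mixed operator lie between \<open>tau_p\<close> and
  \<open>beta_p\<close>, so h is an admissible \<open>H\<close>. It is at least 1 because
  \<open>entr\<close> never exceeds \<open>exp (-1)\<close>.\<close>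

lemma Nmin_Omega_p_less:
  assumes "D \<ge> 2" "unit_vec_c D \<psi>" "verif_op D \<psi> \<Omega>"
    and ed: "0 < \<epsilon>" "\<epsilon> < 1" "0 < \<delta>" "\<delta> < 1"
    and p: "0 \<le> p" "p < 1" "0 < tau_p p (tau_op \<Omega>)"
  shows "\<exists>N\<ge>1. 1 - \<epsilon> \<le> Fmin D \<psi> N \<delta> (Omega_p D p \<Omega>)"
    and "real (Nmin D \<psi> \<epsilon> \<delta> (Omega_p D p \<Omega>))
      < hfun p (nu_op \<Omega>) (tau_op \<Omega>) * ln (1 / ((1 - \<epsilon>) * \<delta>)) / \<epsilon>"
proof -
  obtain v l z where v: "verification D \<psi> \<Omega> v l z"
    and lb: "\<And>k. k < D \<Longrightarrow> k \<noteq> z \<Longrightarrow> tau_op \<Omega> \<le> l k \<and> l k \<le> 1 - nu_op \<Omega>"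
    and nt: "0 < nu_op \<Omega>" "nu_op \<Omega> \<le> 1" "0 \<le> tau_op \<Omega>" "nu_op \<Omega> + tau_op \<Omega> \<le> 1"
    using verif_op_spectrum[OF assms(1-3)] by blast
  let ?b = "beta_p p (nu_op \<Omega>)" and ?t = "tau_p p (tau_op \<Omega>)" and ?H = "hfun p (nu_op \<Omega>) (tau_op \<Omega>)"
  define m where "m k = (1 - p) * l k + p" for k
  interpret vp: verification D \<psi> "Omega_p D p \<Omega>" v m z
    unfolding m_def by (rule verification.verification_Omega_p[OF v])
  have tb: "?t \<le> ?b" "?b < 1" using nt p by (auto intro: tau_p_le_beta_p beta_p_less_one)
  have m: "?t \<le> m k" "m k \<le> ?b" if "k < D" "k \<noteq> z" for k
    using mult_left_mono[of "tau_op \<Omega>" "l k" "1 - p"] mult_left_mono[of "l k" "1 - nu_op \<Omega>" "1 - p"]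
      lb[OF that] p by (auto simp: m_def tau_p_def beta_p_def algebra_simps)
  have pos: "0 < min (entr ?b) (entr ?t)" using tb p by (auto intro!: entr_pos)
  have H1: "1 \<le> ?H"
  proof -
    have "min (entr ?b) (entr ?t) \<le> 1"
      using entr_le_exp_minus_one[of ?t] p by (simp add: min_le_iff_disj)
        (smt (verit) exp_le_one_iff)
    thus ?thesis using pos by (simp add: hfun_entr)
  qed
  have H2: "1 \<le> ?H * entr (m k)" if "k < D" "k \<noteq> z" for k
    using min_entr_le[OF p(3) m[OF that]] pos by (simp add: hfun_entr le_divide_eq)
  have l: "0 < m k" "m k \<le> 1" if "k < D" for k
    using m[of k] that p tb vp.z by (cases "k = z"; fastforce)+
  show "\<exists>N\<ge>1. 1 - \<epsilon> \<le> Fmin D \<psi> N \<delta> (Omega_p D p \<Omega>)"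
    "real (Nmin D \<psi> \<epsilon> \<delta> (Omega_p D p \<Omega>)) < ?H * ln (1 / ((1 - \<epsilon>) * \<delta>)) / \<epsilon>"
    using vp.Nmin_less[OF l H1 H2 ed] by auto
qed

theorem theorem7:
  fixes D :: nat and \<psi> :: "complex vec" and \<Omega> :: "complex mat"
    and \<epsilon> \<delta> p :: real
  assumes "D \<ge> 2"
    and "unit_vec_c D \<psi>"
    and "verif_op D \<psi> \<Omega>"
    and "0 < \<epsilon>" "\<epsilon> < 1" "0 < \<delta>" "\<delta> < 1"
    and "0 \<le> p" "p < 1"
  defines "\<nu> \<equiv> nu_op \<Omega>" and "\<tau> \<equiv> tau_op \<Omega>" and "L \<equiv> ln (1 / ((1 - \<epsilon>) * \<delta>))"
    and "Nv \<equiv> Nmin D \<psi> \<epsilon> \<delta> (Omega_p D p \<Omega>)"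
  shows
    "(p = \<nu> / exp 1 \<longrightarrow>
        (\<exists>N\<ge>1. Fmin D \<psi> N \<delta> (Omega_p D p \<Omega>) \<ge> 1 - \<epsilon>) \<and>
        real Nv < hfun (\<nu> / exp 1) \<nu> \<tau> * L / \<epsilon> \<and>
        hfun (\<nu> / exp 1) \<nu> \<tau> * L / \<epsilon> \<le> hfun0 (\<nu> / exp 1) \<nu> * L / \<epsilon> \<and>
        hfun0 (\<nu> / exp 1) \<nu> * L / \<epsilon> \<le> L / ((1 - \<nu> + \<nu>\<^sup>2 / exp 1) * \<nu> * \<epsilon>) \<and>
        L / ((1 - \<nu> + \<nu>\<^sup>2 / exp 1) * \<nu> * \<epsilon>) \<le> (1 + exp 1 * \<nu> - \<nu>) * L / (\<nu> * \<epsilon>))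
   \<and> (pstar \<nu> \<tau> \<le> p \<and> p \<le> pstar0 \<nu> \<longrightarrow>
        (\<exists>N\<ge>1. Fmin D \<psi> N \<delta> (Omega_p D p \<Omega>) \<ge> 1 - \<epsilon>) \<and>
        real Nv < hfun p \<nu> \<tau> * L / \<epsilon> \<and>
        hfun p \<nu> \<tau> * L / \<epsilon> \<le> hstar0 \<nu> * L / \<epsilon> \<and>
        hstar0 \<nu> * L / \<epsilon> \<le> hfun0 (\<nu> / exp 1) \<nu> * L / \<epsilon> \<and>
        hfun0 (\<nu> / exp 1) \<nu> * L / \<epsilon> \<le> L / ((1 - \<nu> + \<nu>\<^sup>2 / exp 1) * \<nu> * \<epsilon>))"
proof -
  have nt: "0 < \<nu>" "\<nu> \<le> 1" "0 \<le> \<tau>" "\<nu> + \<tau> \<le> 1"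
    unfolding \<nu>_def \<tau>_def using verif_op_spectrum[OF assms(1-3)] by blast+
  have "(1 - \<epsilon>) * \<delta> < 1"
    using mult_strict_mono[of "1 - \<epsilon>" 1 \<delta> 1] assms(4-7) by simp
  hence L: "0 \<le> L" unfolding L_def using assms(4-7) by (intro ln_ge_zero) (simp add: le_divide_eq)
  have scale: "x * L / \<epsilon> \<le> y * L / \<epsilon>" if "x \<le> y" for x y
    using that L assms(4) by (intro divide_right_mono mult_right_mono) auto
  note bound = Nmin_Omega_p_less[OF assms(1-9), folded \<nu>_def \<tau>_def L_def Nv_def]
  have c: "hfun0 (\<nu> / exp 1) \<nu> * L / \<epsilon> \<le> L / ((1 - \<nu> + \<nu>\<^sup>2 / exp 1) * \<nu> * \<epsilon>)"
    using scale[OF hfun0_nu_exp_le[OF nt(1,2)]] by simp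
  have d: "L / ((1 - \<nu> + \<nu>\<^sup>2 / exp 1) * \<nu> * \<epsilon>) \<le> (1 + exp 1 * \<nu> - \<nu>) * L / (\<nu> * \<epsilon>)"
    using divide_right_mono[OF scale[OF inverse_quadratic_le[OF nt(1,2)]], of \<nu>] nt
    by (simp add: mult_ac)
  show ?thesis
  proof (intro conjI impI)
    assume p: "p = \<nu> / exp 1"
    \<comment> \<open>For this choice \<open>p\<close> itself is positive; in the second part
      \<open>p\<close> may be 0 and positivity comes from \<open>pstar\<close>.\<close>
    have t: "0 < tau_p p \<tau>"
      using tau_p_ge[of \<tau> p] nt assms(9) p by (smt (verit) divide_pos_pos exp_gt_zero)
    show "\<exists>N\<ge>1. Fmin D \<psi> N \<delta> (Omega_p D p \<Omega>) \<ge> 1 - \<epsilon>" using bound(1)[OF t] .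
    show "real Nv < hfun (\<nu> / exp 1) \<nu> \<tau> * L / \<epsilon>" using bound(2)[OF t] p by simp
    show "hfun (\<nu> / exp 1) \<nu> \<tau> * L / \<epsilon> \<le> hfun0 (\<nu> / exp 1) \<nu> * L / \<epsilon>"
      using nt assms(9) p by (intro scale hfun_le_hfun0) auto
  next
    assume p: "pstar \<nu> \<tau> \<le> p \<and> p \<le> pstar0 \<nu>"
    hence t: "0 < tau_p p \<tau>" using nt assms(9) by (intro tau_p_pos_of_pstar_le) auto
    show "\<exists>N\<ge>1. Fmin D \<psi> N \<delta> (Omega_p D p \<Omega>) \<ge> 1 - \<epsilon>" using bound(1)[OF t] .
    show "real Nv < hfun p \<nu> \<tau> * L / \<epsilon>" using bound(2)[OF t] .
    show "hfun p \<nu> \<tau> * L / \<epsilon> \<le> hstar0 \<nu> * L / \<epsilon>"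
      using nt assms(9) p by (intro scale hfun_le_hstar0) auto
    show "hstar0 \<nu> * L / \<epsilon> \<le> hfun0 (\<nu> / exp 1) \<nu> * L / \<epsilon>"
      by (intro scale hstar0_le_hfun0 nt)
  qed (rule c d)+
qed

end
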